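(* Let $q$ be a prime power and let $b\geq 1$ be an integer. Then, as formal power series in $t$, $$\sum_{n\geq 0} \frac{\#\{(A,B)\in \mathrm{Mat}_n(\mathbb{F}_q)^2: AB=BA,\ A^b=0\}}{|\mathrm{GL}_n(\mathbb{F}_q)|}\, t^n=\prod_{i=1}^b \prod_{j\geq 0} \frac{1}{1-t^i q^{-j}}.$$
   Context: $\mathbb{F}_q$ is the finite field with $q$ elements. The infinite product is read as a power series in $t$ whose coefficients are convergent (real) numbers. The $n=0$ term of the left-hand side is $1$. *)

theory Defs
  imports
    "HOL-Computational_Algebra.Formal_Power_Series"
    "Jordan_Normal_Form.Matrix"
begin

definition GL_mats :: "'a::field itself \<Rightarrow> nat \<Rightarrow> 'a mat set" where
  "GL_mats _ n = {A \<in> carrier_mat n n. invertible_mat A}"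

definition commuting_nilp_pairs :: "'a::field itself \<Rightarrow> nat \<Rightarrow> nat \<Rightarrow> ('a mat \<times> 'a mat) set" where
  "commuting_nilp_pairs _ b n =
     {(A, B). A \<in> carrier_mat n n \<and> B \<in> carrier_mat n n \<and>
              A * B = B * A \<and> A ^\<^sub>m b = 0\<^sub>m n n}"

text \<open>
  Infinite products of real power series are taken coefficientwise, with respect to the usual
  topology of the reals. The topology that the library puts on \<^typ>\<open>real fps\<close> is the one in
  which convergence means that every coefficient is eventually constant; an infinite product of
  factors like \<^term>\<open>1 / (1 - fps_const (1 / 2 ^ j) * fps_X) :: real fps\<close> does not converge in it.
\<close>

definition fps_coeffwise_convergent_prod :: "(nat \<Rightarrow> real fps) \<Rightarrow> bool" where
  "fps_coeffwise_convergent_prod f \<longleftrightarrow>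
     (\<forall>n. convergent (\<lambda>N. fps_nth (\<Prod>j<N. f j) n))"

definition fps_coeffwise_prodinf :: "(nat \<Rightarrow> real fps) \<Rightarrow> real fps" where
  "fps_coeffwise_prodinf f = Abs_fps (\<lambda>n. lim (\<lambda>N. fps_nth (\<Prod>j<N. f j) n))"

end

theory Submission
  imports
    Defs
    "HOL-Library.Cardinality"
    "Jordan_Normal_Form.Determinant"
    "Jordan_Normal_Form.Gauss_Jordan_Elimination"
begin

text \<open>
  The pairs \<open>(A, B)\<close> are counted according to the rank \<open>r\<close> and the nullity \<open>w\<close> of \<open>A\<close>, by passing to the
  image \<open>U\<close> of \<open>A\<close>. As \<open>B\<close> commutes with \<open>A\<close>, both matrices restrict to \<open>U\<close>, and the restriction
  \<open>(A\<^sub>1, B\<^sub>1)\<close> is a commuting pair in which the nilpotency exponent has dropped by one.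

  Conversely, choose a complement of \<open>U\<close>. The matrix \<open>A\<close> is \<open>(A\<^sub>1 | \<alpha>)\<close> above zero rows, where
  \<open>(A\<^sub>1 | \<alpha>)\<close> has full row rank because \<open>U\<close> is the image; the number of such \<open>\<alpha>\<close> depends only
  on the rank of \<open>A\<^sub>1\<close> (\<open>card_full_row_rank_extensions\<close>). The last \<open>w\<close> columns \<open>Z\<close> of \<open>B\<close> are subject
  to the single condition \<open>(A\<^sub>1 | \<alpha>) Z = B\<^sub>1 \<alpha>\<close>, a linear system of full row rank, which has
  \<open>q\<close> to the power \<open>w\<^sup>2\<close> solutions (\<open>card_adapted_pairs\<close>). No classification of nilpotent matrices is needed.
  After division by the order of the general linear group, with \<open>g m\<close> denoting the number of all
  matrices of size \<open>m\<close> divided by the number of invertible ones, the counts \<open>c\<close> satisfy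
  (\<open>pair_ratio_Suc\<close>)

    \<open>c (b + 1) w r = (\<Sum>k \<le> min w r. g (w - k) * c b k (r - k))\<close>.

  Let \<open>H b s\<close> be the generating function of \<open>c b w r\<close> in which the rank has weight \<open>1\<close> and
  the nullity has weight \<open>s + 1\<close>, and let \<open>G t\<close> be the generating function of \<open>g\<close>. The recurrence
  reads \<open>H (b + 1) s = G (t\<^bsup>s+1\<^esup>) * H b (s + 1)\<close>, so that \<open>H b 0\<close>, which counts all pairs by size,
  is the product of \<open>G (t\<^sup>i)\<close> over \<open>1 \<le> i \<le> b\<close> (\<open>pair_series_eq_prod\<close>).

  Finally \<open>g m\<close> is the product of \<open>1 / (1 - x\<^sup>l)\<close> over \<open>1 \<le> l \<le> m\<close> with \<open>x = 1 / q\<close>, and Euler's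
  identity turns \<open>G t\<close> into the infinite product of \<open>1 / (1 - x\<^sup>j t)\<close>. The coefficients of the
  finite products are known in closed form (\<open>fps_nth_partial_product\<close>), which gives the coefficientwise
  convergence at the same time.
\<close>

section \<open>Stacking matrices\<close>

text \<open>Horizontal concatenation, the counterpart of \<^const>\<open>append_rows\<close>.\<close>

definition append_cols :: "'a :: zero mat \<Rightarrow> 'a mat \<Rightarrow> 'a mat" (infixr \<open>@\<^sub>c\<close> 66) where
  "A @\<^sub>c B = four_block_mat A B (0\<^sub>m 0 (dim_col A)) (0\<^sub>m 0 (dim_col B))"

lemma carrier_append_cols[simp, intro]:
  "A \<in> carrier_mat m n1 \<Longrightarrow> B \<in> carrier_mat m n2 \<Longrightarrow> A @\<^sub>c B \<in> carrier_mat m (n1 + n2)"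
  by (auto simp: append_cols_def)

lemma index_append_cols:
  assumes "A \<in> carrier_mat m n1" "B \<in> carrier_mat m n2" "i < m" "j < n1 + n2"
  shows "(A @\<^sub>c B) $$ (i, j) = (if j < n1 then A $$ (i, j) else B $$ (i, j - n1))"
  using assms by (auto simp: append_cols_def)

lemma index_append_rows:
  assumes "A \<in> carrier_mat m1 n" "B \<in> carrier_mat m2 n" "i < m1 + m2" "j < n"
  shows "(A @\<^sub>r B) $$ (i, j) = (if i < m1 then A $$ (i, j) else B $$ (i - m1, j))"
  using assms by (auto simp: append_rows_def)

lemma append_rows_eq_iff:
  assumes "A \<in> carrier_mat m1 n" "A' \<in> carrier_mat m1 n" "B \<in> carrier_mat m2 n" "B' \<in> carrier_mat m2 n"
  shows "A @\<^sub>r B = A' @\<^sub>r B' \<longleftrightarrow> A = A' \<and> B = B'"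
proof
  assume eq: "A @\<^sub>r B = A' @\<^sub>r B'"
  have "A $$ (i, j) = A' $$ (i, j)" if "i < m1" "j < n" for i j
    using index_append_rows[OF assms(1,3), of i j] index_append_rows[OF assms(2,4), of i j] that eq
    by simp
  moreover have "B $$ (i, j) = B' $$ (i, j)" if "i < m2" "j < n" for i j
    using index_append_rows[OF assms(1,3), of "m1 + i" j]
      index_append_rows[OF assms(2,4), of "m1 + i" j] that eq
    by simp
  ultimately show "A = A' \<and> B = B'" using assms by (auto intro!: eq_matI)
qed auto

lemma append_cols_eq_iff:
  assumes "A \<in> carrier_mat m n1" "A' \<in> carrier_mat m n1" "B \<in> carrier_mat m n2" "B' \<in> carrier_mat m n2"
  shows "A @\<^sub>c B = A' @\<^sub>c B' \<longleftrightarrow> A = A' \<and> B = B'"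
proof
  assume eq: "A @\<^sub>c B = A' @\<^sub>c B'"
  have "A $$ (i, j) = A' $$ (i, j)" if "i < m" "j < n1" for i j
    using index_append_cols[OF assms(1,3), of i j] index_append_cols[OF assms(2,4), of i j] that eq
    by simp
  moreover have "B $$ (i, j) = B' $$ (i, j)" if "i < m" "j < n2" for i j
    using index_append_cols[OF assms(1,3), of i "n1 + j"]
      index_append_cols[OF assms(2,4), of i "n1 + j"] that eq
    by simp
  ultimately show "A = A' \<and> B = B'" using assms by (auto intro!: eq_matI)
qed auto

lemma append_rows_split:
  assumes "M \<in> carrier_mat (m1 + m2) n"
  obtains A B where "A \<in> carrier_mat m1 n" "B \<in> carrier_mat m2 n" "M = A @\<^sub>r B"
proof
  show "mat m1 n (\<lambda>(i, j). M $$ (i, j)) \<in> carrier_mat m1 n" by simp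
  show "mat m2 n (\<lambda>(i, j). M $$ (m1 + i, j)) \<in> carrier_mat m2 n" by simp
  show "M = mat m1 n (\<lambda>(i, j). M $$ (i, j)) @\<^sub>r mat m2 n (\<lambda>(i, j). M $$ (m1 + i, j))"
    using assms by (intro eq_matI) (auto simp: append_rows_def)
qed

lemma append_cols_split:
  assumes "M \<in> carrier_mat m (n1 + n2)"
  obtains A B where "A \<in> carrier_mat m n1" "B \<in> carrier_mat m n2" "M = A @\<^sub>c B"
proof
  show "mat m n1 (\<lambda>(i, j). M $$ (i, j)) \<in> carrier_mat m n1" by simp
  show "mat m n2 (\<lambda>(i, j). M $$ (i, n1 + j)) \<in> carrier_mat m n2" by simp
  show "M = mat m n1 (\<lambda>(i, j). M $$ (i, j)) @\<^sub>c mat m n2 (\<lambda>(i, j). M $$ (i, n1 + j))"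
    using assms by (intro eq_matI) (auto simp: append_cols_def)
qed

lemma append_rows_cols:
  assumes "A \<in> carrier_mat m1 n1" "B \<in> carrier_mat m1 n2" "C \<in> carrier_mat m2 n1" "D \<in> carrier_mat m2 n2"
  shows "(A @\<^sub>c B) @\<^sub>r (C @\<^sub>c D) = four_block_mat A B C D"
  using assms by (intro eq_matI) (auto simp: append_rows_def append_cols_def)

lemma append_rows_zero[simp]: "0\<^sub>m m1 n @\<^sub>r 0\<^sub>m m2 n = 0\<^sub>m (m1 + m2) n"
  by (intro eq_matI) (auto simp: append_rows_def)

lemma append_rows_mult:
  fixes A :: "'a :: semiring_0 mat"
  assumes "A \<in> carrier_mat m1 n" "B \<in> carrier_mat m2 n" "M \<in> carrier_mat n k"
  shows "(A @\<^sub>r B) * M = (A * M) @\<^sub>r (B * M)"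
proof (intro eq_matI)
  fix i j assume "i < dim_row ((A * M) @\<^sub>r (B * M))" "j < dim_col ((A * M) @\<^sub>r (B * M))"
  then have ij: "i < m1 + m2" "j < k" using assms by (auto simp: append_rows_def)
  have "row (A @\<^sub>r B) i = (if i < m1 then row A i else row B (i - m1))"
    using assms ij by (intro eq_vecI) (auto simp: append_rows_def)
  with ij assms show "((A @\<^sub>r B) * M) $$ (i, j) = ((A * M) @\<^sub>r (B * M)) $$ (i, j)"
    by (auto simp: append_rows_def)
qed (use assms in \<open>auto simp: append_rows_def\<close>)

lemma mult_append_cols:
  fixes M :: "'a :: semiring_0 mat"
  assumes "A \<in> carrier_mat n k1" "B \<in> carrier_mat n k2" "M \<in> carrier_mat m n"
  shows "M * (A @\<^sub>c B) = (M * A) @\<^sub>c (M * B)"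
proof (intro eq_matI)
  fix i j assume "i < dim_row ((M * A) @\<^sub>c (M * B))" "j < dim_col ((M * A) @\<^sub>c (M * B))"
  then have ij: "i < m" "j < k1 + k2" using assms by (auto simp: append_cols_def)
  have "col (A @\<^sub>c B) j = (if j < k1 then col A j else col B (j - k1))"
    using assms ij by (intro eq_vecI) (auto simp: append_cols_def)
  with ij assms show "(M * (A @\<^sub>c B)) $$ (i, j) = ((M * A) @\<^sub>c (M * B)) $$ (i, j)"
    by (auto simp: append_cols_def)
qed (use assms in \<open>auto simp: append_cols_def\<close>)

lemma append_cols_mult_append_rows:
  fixes A :: "'a :: comm_semiring_1 mat"
  assumes "A \<in> carrier_mat m n1" "B \<in> carrier_mat m n2" "C \<in> carrier_mat n1 k" "D \<in> carrier_mat n2 k"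
  shows "(A @\<^sub>c B) * (C @\<^sub>r D) = A * C + B * D"
proof -
  have "(A @\<^sub>c B) * (C @\<^sub>r D)
      = four_block_mat A B (0\<^sub>m 0 n1) (0\<^sub>m 0 n2) * four_block_mat C (0\<^sub>m n1 0) D (0\<^sub>m n2 0)"
    using assms by (simp add: append_cols_def append_rows_def)
  also have "\<dots> = four_block_mat (A * C + B * D) (A * 0\<^sub>m n1 0 + B * 0\<^sub>m n2 0)
     (0\<^sub>m 0 n1 * C + 0\<^sub>m 0 n2 * D) (0\<^sub>m 0 n1 * 0\<^sub>m n1 0 + 0\<^sub>m 0 n2 * 0\<^sub>m n2 0)"
    using assms by (intro mult_four_block_mat) auto
  also have "\<dots> = A * C + B * D"
    using assms by (intro eq_matI) auto
  finally show ?thesis .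
qed

section \<open>The general linear group\<close>

abbreviation GL :: "nat \<Rightarrow> 'a :: field mat set" where
  "GL n \<equiv> GL_mats TYPE('a) n"

lemma GL_carrier: "A \<in> GL n \<Longrightarrow> A \<in> carrier_mat n n"
  by (simp add: GL_mats_def)

lemma GL_I:
  assumes "A \<in> carrier_mat n n" "B \<in> carrier_mat n n" "A * B = 1\<^sub>m n"
  shows "A \<in> GL n"
proof -
  have "B * A = 1\<^sub>m n" using mat_mult_left_right_inverse[OF assms] .
  with assms show ?thesis
    unfolding GL_mats_def invertible_mat_def inverts_mat_def by auto
qed

lemma GL_inverse:
  assumes "A \<in> GL n"
  obtains B where "B \<in> GL n" "A * B = 1\<^sub>m n" "B * A = 1\<^sub>m n"
proof -
  from assms obtain B where A: "A \<in> carrier_mat n n" and B: "A * B = 1\<^sub>m n" "B * A = 1\<^sub>m (dim_row B)"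
    unfolding GL_mats_def invertible_mat_def inverts_mat_def by auto
  have "dim_col B = n" using arg_cong[OF B(1), of dim_col] by (simp only: index_mult_mat index_one_mat)
  moreover have "dim_row B = n"
    using arg_cong[OF B(2), of dim_col] A by (simp only: index_mult_mat index_one_mat carrier_matD)
  ultimately have Bc: "B \<in> carrier_mat n n" by (intro carrier_matI)
  with B have "B * A = 1\<^sub>m n" by simp
  moreover have "B \<in> GL n" using GL_I[OF Bc A] \<open>B * A = 1\<^sub>m n\<close> by simp
  ultimately show ?thesis using that B by blast
qed

lemma GL_iff_det: "A \<in> GL n \<longleftrightarrow> A \<in> carrier_mat n n \<and> det A \<noteq> 0"
proof
  assume A: "A \<in> GL n"
  then obtain B where "B \<in> GL n" "A * B = 1\<^sub>m n" by (rule GL_inverse)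
  then have "det A * det B = 1" using det_mult[OF GL_carrier[OF A] GL_carrier[of B n]] by simp
  then show "A \<in> carrier_mat n n \<and> det A \<noteq> 0" using GL_carrier[OF A] by auto
next
  assume "A \<in> carrier_mat n n \<and> det A \<noteq> 0"
  then have A: "A \<in> carrier_mat n n" and "det A \<noteq> 0" by auto
  from det_non_zero_imp_unit[OF this, of "()"] obtain B
    where "B \<in> carrier_mat n n" "A * B = 1\<^sub>m n" by (auto simp: Units_def ring_mat_def)
  with A show "A \<in> GL n" by (rule GL_I)
qed

lemma GL_mult: "A \<in> GL n \<Longrightarrow> B \<in> GL n \<Longrightarrow> A * B \<in> GL n"
  by (auto simp: GL_iff_det det_mult[of _ n])

lemma GL_one: "1\<^sub>m n \<in> GL n"
  by (simp add: GL_iff_det)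

lemma GL_mult_left_cancel:
  assumes "A \<in> GL n" "B \<in> carrier_mat n k" "C \<in> carrier_mat n k"
  shows "A * B = A * C \<longleftrightarrow> B = C"
proof
  assume eq: "A * B = A * C"
  obtain A' where A': "A' \<in> GL n" "A' * A = 1\<^sub>m n" using GL_inverse[OF assms(1)] .
  have "A' * (A * B) = A' * (A * C)" by (simp add: eq)
  then show "B = C"
    using A' assms GL_carrier[OF A'(1)] GL_carrier[OF assms(1)]
    by (simp flip: assoc_mult_mat[of A' n n A n])
qed auto

lemma GL_mult_right_cancel:
  assumes "A \<in> GL n" "B \<in> carrier_mat k n" "C \<in> carrier_mat k n"
  shows "B * A = C * A \<longleftrightarrow> B = C"
proof
  assume eq: "B * A = C * A"
  obtain A' where A': "A' \<in> GL n" "A * A' = 1\<^sub>m n" using GL_inverse[OF assms(1)] .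
  have "(B * A) * A' = (C * A) * A'" by (simp add: eq)
  then show "B = C"
    using A' assms GL_carrier[OF A'(1)] GL_carrier[OF assms(1)]
    by (simp add: assoc_mult_mat[of _ k n A n A' n])
qed auto

lemma card_carrier_mat:
  "card (carrier_mat m n :: 'a :: finite mat set) = CARD('a) ^ (m * n)"
proof -
  have "bij_betw (\<lambda>f. mat m n f) ({..<m} \<times> {..<n} \<rightarrow>\<^sub>E (UNIV :: 'a set)) (carrier_mat m n)"
  proof (rule bij_betwI[where g = "\<lambda>M. restrict (\<lambda>p. M $$ p) ({..<m} \<times> {..<n})"])
    fix M :: "'a mat" assume "M \<in> carrier_mat m n"
    then show "mat m n (restrict (\<lambda>p. M $$ p) ({..<m} \<times> {..<n})) = M"
      by (intro eq_matI) auto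
  qed (auto simp: fun_eq_iff PiE_def extensional_def)
  then have "card (carrier_mat m n :: 'a mat set) = card ({..<m} \<times> {..<n} \<rightarrow>\<^sub>E (UNIV :: 'a set))"
    by (metis bij_betw_same_card)
  also have "\<dots> = CARD('a) ^ (m * n)" by (simp add: card_PiE)
  finally show ?thesis .
qed

lemma finite_carrier_mat [simp]: "finite (carrier_mat m n :: 'a :: finite mat set)"
  by (rule card_ge_0_finite) (simp add: card_carrier_mat card_gt_0_iff)

lemma finite_GL [simp]: "finite (GL n :: 'a :: {field, finite} mat set)"
  by (rule finite_subset[OF _ finite_carrier_mat[of n n]]) (auto simp: GL_mats_def)

lemma card_GL_pos: "card (GL n :: 'a :: {field, finite} mat set) > 0"
  using GL_one by (auto simp: card_gt_0_iff)

section \<open>Matrices of full row rank\<close>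

text \<open>The matrices of the linear surjections onto a space of dimension \<open>r\<close>, characterised by the
  existence of a right inverse.\<close>

definition full_row_rank :: "nat \<Rightarrow> nat \<Rightarrow> 'a :: field mat set" where
  "full_row_rank r n = {C \<in> carrier_mat r n. \<exists>D \<in> carrier_mat n r. C * D = 1\<^sub>m r}"

lemma full_row_rankI:
  "C \<in> carrier_mat r n \<Longrightarrow> D \<in> carrier_mat n r \<Longrightarrow> C * D = 1\<^sub>m r \<Longrightarrow> C \<in> full_row_rank r n"
  by (auto simp: full_row_rank_def)

lemma full_row_rank_carrier: "C \<in> full_row_rank r n \<Longrightarrow> C \<in> carrier_mat r n"
  by (simp add: full_row_rank_def)

lemma full_row_rank_le:
  assumes "(C :: 'a :: {field, finite} mat) \<in> full_row_rank r n"
  shows "r \<le> n"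
proof -
  from assms obtain D where C: "C \<in> carrier_mat r n" and D: "D \<in> carrier_mat n r" "C * D = 1\<^sub>m r"
    by (auto simp: full_row_rank_def)
  \<comment> \<open>Left multiplication by a right inverse embeds the columns of length \<open>r\<close> into those of length \<open>n\<close>.\<close>
  have "inj_on (\<lambda>X. D * X) (carrier_mat r 1)"
  proof (rule inj_onI)
    fix X Y :: "'a mat" assume X: "X \<in> carrier_mat r 1" and Y: "Y \<in> carrier_mat r 1"
      and eq: "D * X = D * Y"
    have "C * (D * X) = C * (D * Y)" by (simp add: eq)
    then show "X = Y" using C D X Y by (simp flip: assoc_mult_mat[of C r n D r])
  qed
  moreover have "(\<lambda>X. D * X) ` carrier_mat r 1 \<subseteq> carrier_mat n 1" using D by auto
  ultimately have "card (carrier_mat r 1 :: 'a mat set) \<le> card (carrier_mat n 1 :: 'a mat set)"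
    by (intro card_inj_on_le) auto
  then have "CARD('a) ^ r \<le> CARD('a) ^ n" by (simp add: card_carrier_mat)
  moreover have "CARD('a) > 1"
    using card_mono[of UNIV "{0, 1 :: 'a}"] by auto
  ultimately show ?thesis by (simp add: power_increasing_iff)
qed

lemma full_row_rank_square: "(full_row_rank n n :: 'a :: field mat set) = GL n"
proof (intro equalityI subsetI)
  fix A :: "'a mat" assume "A \<in> full_row_rank n n"
  then show "A \<in> GL n" by (auto simp: full_row_rank_def intro: GL_I)
next
  fix A :: "'a mat" assume A: "A \<in> GL n"
  then obtain B where "B \<in> GL n" "A * B = 1\<^sub>m n" by (rule GL_inverse)
  with A show "A \<in> full_row_rank n n" by (auto simp: full_row_rank_def dest: GL_carrier)
qed

lemma full_row_rank_right_factor: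
  assumes "A * B \<in> full_row_rank r n" "A \<in> carrier_mat r k" "B \<in> carrier_mat k n"
  shows "A \<in> full_row_rank r k"
proof -
  from assms obtain D where "D \<in> carrier_mat n r" "A * B * D = 1\<^sub>m r"
    by (auto simp: full_row_rank_def)
  with assms have "A * (B * D) = 1\<^sub>m r" "B * D \<in> carrier_mat k r" by auto
  with assms show ?thesis by (auto simp: full_row_rank_def)
qed

lemma full_row_rank_mult:
  assumes "A \<in> full_row_rank r k" "B \<in> full_row_rank k n"
  shows "A * B \<in> full_row_rank r n"
proof -
  from assms obtain C D where A: "A \<in> carrier_mat r k" and B: "B \<in> carrier_mat k n"
    and C: "C \<in> carrier_mat k r" "A * C = 1\<^sub>m r" and D: "D \<in> carrier_mat n k" "B * D = 1\<^sub>m k"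
    by (auto simp: full_row_rank_def)
  have "(A * B) * (D * C) = A * ((B * D) * C)"
    using assoc_mult_mat[OF A B, of "D * C" r] assoc_mult_mat[OF B D(1) C(1)] C(1) D(1) by auto
  also have "\<dots> = 1\<^sub>m r" using C D by simp
  finally have "(A * B) * (D * C) = 1\<^sub>m r" .
  moreover have "A * B \<in> carrier_mat r n" "D * C \<in> carrier_mat n r" using A B C D by auto
  ultimately show ?thesis unfolding full_row_rank_def by blast
qed

lemma full_row_rank_GL_iff:
  assumes "P \<in> GL r" "Q \<in> GL n" "C \<in> carrier_mat r n"
  shows "P * C \<in> full_row_rank r n \<longleftrightarrow> C \<in> full_row_rank r n"
    and "C * Q \<in> full_row_rank r n \<longleftrightarrow> C \<in> full_row_rank r n"
proof -
  obtain P' where P': "P' \<in> GL r" "P' * P = 1\<^sub>m r" using GL_inverse[OF assms(1)] .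
  have "P' * (P * C) = C"
    using P' assms GL_carrier[OF P'(1)] GL_carrier[OF assms(1)]
    by (simp flip: assoc_mult_mat[of P' r r P r C n])
  then show "P * C \<in> full_row_rank r n \<longleftrightarrow> C \<in> full_row_rank r n"
    using full_row_rank_mult[of P' r r "P * C" n] full_row_rank_mult[of P r r C n] P' assms
    by (metis full_row_rank_square)
  show "C * Q \<in> full_row_rank r n \<longleftrightarrow> C \<in> full_row_rank r n"
    using full_row_rank_mult[of C r n Q n] full_row_rank_right_factor[of C Q r n n] assms
    by (metis full_row_rank_square full_row_rank_carrier GL_carrier)
qed

text \<open>Gauss--Jordan elimination, keeping only that the nonzero rows of the echelon form are
  linearly independent.\<close>

lemma echelon_form_exists:
  assumes A: "(A :: 'a :: field mat) \<in> carrier_mat m n"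
  obtains R r C where "R \<in> GL m" "r \<le> m" "C \<in> full_row_rank r n" "R * A = C @\<^sub>r 0\<^sub>m (m - r) n"
proof -
  define E where "E = gauss_jordan_single A"
  note gj = gauss_jordan_single[OF A E_def[symmetric]]
  from gj(4) obtain P Q where PQ: "E = P * A" "P \<in> carrier_mat m m" "Q \<in> carrier_mat m m"
    "P * Q = 1\<^sub>m m" by auto
  from gj(2,3) obtain f where f: "pivot_fun E f n" by (auto simp: row_echelon_form_def)
  have dE: "dim_row E = m" "dim_col E = n" using gj(2) by auto
  note p = pivot_funD[OF dE(1) f]
  define S where "S = {i. i < m \<and> f i = n}"
  \<comment> \<open>The first row without a pivot, if there is one; from there on all rows vanish.\<close>
  define r where "r = (if S = {} then m else Min S)"
  have fin: "finite S" by (simp add: S_def)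
  have rm: "r \<le> m"
  proof (cases "S = {}")
    case False
    then have "Min S \<in> S" using Min_in[OF fin] by blast
    moreover have "S \<subseteq> {..<m}" by (auto simp: S_def)
    ultimately have "Min S < m" by blast
    then show ?thesis using False by (simp add: r_def)
  qed (simp add: r_def)
  have lt: "f i < n" if "i < r" for i
  proof -
    have "i < m" using that rm by simp
    have "i \<notin> S" using that Min_le[OF fin, of i] by (auto simp: r_def split: if_splits)
    then show ?thesis using p(1)[OF \<open>i < m\<close>] \<open>i < m\<close> by (auto simp: S_def)
  qed
  have eqn: "f i = n" if "r \<le> i" "i < m" for i
    using that
  proof (induction i rule: dec_induct)
    case base
    then have "r \<in> S" unfolding r_def using Min_in[OF fin] by (auto split: if_splits)
    then show ?case by (simp add: S_def)
  next
    case (step i)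
    then show ?case using p(3)[of i] p(1)[of "Suc i"] by auto
  qed
  define C where "C = mat r n (\<lambda>ij. E $$ ij)"
  \<comment> \<open>The right inverse selects the pivot columns, which form an identity matrix.\<close>
  define D where "D = mat n r (\<lambda>(j, i). if j = f i then 1 else 0 :: 'a)"
  have C: "C \<in> carrier_mat r n" and D: "D \<in> carrier_mat n r" by (auto simp: C_def D_def)
  have "C * D = 1\<^sub>m r"
  proof (intro eq_matI)
    fix i j assume "i < dim_row (1\<^sub>m r :: 'a mat)" "j < dim_col (1\<^sub>m r :: 'a mat)"
    then have ij: "i < r" "j < r" by auto
    have "(C * D) $$ (i, j) = (\<Sum>k<n. C $$ (i, k) * D $$ (k, j))"
      using C D ij by (auto simp: scalar_prod_def atLeast0LessThan)
    also have "\<dots> = (\<Sum>k<n. if k = f j then E $$ (i, f j) else 0)"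
      using ij by (intro sum.cong) (auto simp: C_def D_def)
    also have "\<dots> = E $$ (i, f j)" using lt[OF ij(2)] by simp
    also have "\<dots> = (if i = j then 1 else 0)"
      using p(4)[of j] p(5)[of j i] lt[OF ij(2)] ij rm by auto
    finally show "(C * D) $$ (i, j) = (1\<^sub>m r :: 'a mat) $$ (i, j)" using ij by simp
  qed (use C D in auto)
  then have "C \<in> full_row_rank r n" using C D by (auto simp: full_row_rank_def)
  moreover have "E = C @\<^sub>r 0\<^sub>m (m - r) n"
  proof (intro eq_matI)
    fix i j
    assume "i < dim_row (C @\<^sub>r 0\<^sub>m (m - r) n)" "j < dim_col (C @\<^sub>r 0\<^sub>m (m - r) n)"
    then have ij: "i < r + (m - r)" "j < n" using C by (auto simp: append_rows_def)
    show "E $$ (i, j) = (C @\<^sub>r 0\<^sub>m (m - r) n) $$ (i, j)"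
      unfolding index_append_rows[OF C zero_carrier_mat ij]
      using ij p(2)[of i j] eqn[of i] by (simp add: C_def)
  qed (use C dE rm in \<open>simp_all add: append_rows_def\<close>)
  moreover have "P \<in> GL m" using PQ(2-4) by (rule GL_I)
  ultimately show ?thesis using that[of P r C] PQ(1) rm by simp
qed

lemma four_block_GL_lower_left_zero:
  assumes "A \<in> carrier_mat r r" "B \<in> carrier_mat r w" "D \<in> carrier_mat w w"
  shows "four_block_mat A B (0\<^sub>m w r) D \<in> GL (r + w) \<longleftrightarrow> A \<in> GL r \<and> D \<in> GL w"
  using assms by (auto simp: GL_iff_det det_four_block_mat_lower_left_zero[of A r B w])

lemma four_block_GL_upper_right_zero:
  assumes "A \<in> carrier_mat r r" "C \<in> carrier_mat w r" "D \<in> carrier_mat w w"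
  shows "four_block_mat A (0\<^sub>m r w) C D \<in> GL (r + w) \<longleftrightarrow> A \<in> GL r \<and> D \<in> GL w"
  using assms by (auto simp: GL_iff_det det_four_block_mat_upper_right_zero[of A r _ w C])

lemma projection_mult_append_rows:
  assumes "A \<in> carrier_mat r n" "B \<in> carrier_mat w n"
  shows "(1\<^sub>m r @\<^sub>c 0\<^sub>m r w) * (A @\<^sub>r B) = (A :: 'a :: comm_semiring_1 mat)"
    and "(0\<^sub>m w r @\<^sub>c 1\<^sub>m w) * (A @\<^sub>r B) = B"
  using assms by (subst append_cols_mult_append_rows; auto)+

lemma projection_full_row_rank:
  "(1\<^sub>m r @\<^sub>c 0\<^sub>m r w :: 'a :: field mat) \<in> full_row_rank r (r + w)"
  "(0\<^sub>m w r @\<^sub>c 1\<^sub>m w :: 'a mat) \<in> full_row_rank w (r + w)"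
proof -
  show "(1\<^sub>m r @\<^sub>c 0\<^sub>m r w :: 'a mat) \<in> full_row_rank r (r + w)"
    by (rule full_row_rankI[OF _ _ projection_mult_append_rows(1)[where B = "0\<^sub>m w r"]]) auto
  show "(0\<^sub>m w r @\<^sub>c 1\<^sub>m w :: 'a mat) \<in> full_row_rank w (r + w)"
    by (rule full_row_rankI[OF _ _ projection_mult_append_rows(2)[where A = "0\<^sub>m r w"]]) auto
qed

lemma GL_top_rows_full_row_rank:
  assumes "C @\<^sub>r C' \<in> GL (r + w)" "C \<in> carrier_mat r (r + w)" "C' \<in> carrier_mat w (r + w)"
  shows "C \<in> full_row_rank r (r + w)"
proof -
  have "(1\<^sub>m r @\<^sub>c 0\<^sub>m r w) * (C @\<^sub>r C') \<in> full_row_rank r (r + w)"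
    using full_row_rank_GL_iff(2)[OF GL_one assms(1)] projection_full_row_rank(1) by auto
  then show ?thesis using assms by (simp add: projection_mult_append_rows)
qed

text \<open>Independent rows extend to a basis. Row reduction of the transpose gives an invertible \<open>Q\<close>
  such that \<open>C * Q\<close> is an invertible square block followed by zero columns.\<close>

lemma full_row_rank_completion:
  assumes C: "(C :: 'a :: {field, finite} mat) \<in> full_row_rank r (r + w)"
  obtains C' where "C' \<in> carrier_mat w (r + w)" "C @\<^sub>r C' \<in> GL (r + w)"
proof -
  let ?n = "r + w"
  have Cc: "C \<in> carrier_mat r ?n" using C by (rule full_row_rank_carrier)
  then have Ct: "transpose_mat C \<in> carrier_mat ?n r" by simp
  obtain R k E where R: "R \<in> GL ?n" and k: "k \<le> ?n" and E: "E \<in> full_row_rank k r"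
    and RE: "R * transpose_mat C = E @\<^sub>r 0\<^sub>m (?n - k) r"
    by (rule echelon_form_exists[OF Ct])
  have Ec: "E \<in> carrier_mat k r" and Rc: "R \<in> carrier_mat ?n ?n"
    using E R by (auto dest: full_row_rank_carrier GL_carrier)
  define Q where "Q = transpose_mat R"
  have Q: "Q \<in> GL ?n" and Qc: "Q \<in> carrier_mat ?n ?n"
    using R Rc by (auto simp: GL_iff_det Q_def det_transpose)
  define F where "F = transpose_mat E"
  have F: "F \<in> carrier_mat r k" using Ec by (simp add: F_def)
  have "C * Q = transpose_mat (R * transpose_mat C)"
    unfolding Q_def by (subst transpose_mult[OF Rc Ct]) simp
  also have "\<dots> = F @\<^sub>c 0\<^sub>m r (?n - k)"
    unfolding RE F_def using Ec by (intro eq_matI) (auto simp: append_rows_def append_cols_def)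
  finally have CQ: "C * Q = F @\<^sub>c 0\<^sub>m r (?n - k)" .
  also have "\<dots> = F * (1\<^sub>m k @\<^sub>c 0\<^sub>m k (?n - k))"
    using F by (subst mult_append_cols) auto
  finally have "F * (1\<^sub>m k @\<^sub>c 0\<^sub>m k (?n - k)) \<in> full_row_rank r ?n"
    using full_row_rank_GL_iff(2)[OF GL_one Q Cc] C by simp
  then have "F \<in> full_row_rank r k"
    using full_row_rank_right_factor F k
    by (metis carrier_append_cols le_add_diff_inverse one_carrier_mat zero_carrier_mat)
  then have "r = k" using full_row_rank_le E by (metis le_antisym)
  with \<open>F \<in> full_row_rank r k\<close> have FG: "F \<in> GL r" by (simp add: full_row_rank_square)
  have CQ: "C * Q = F @\<^sub>c 0\<^sub>m r w" using CQ \<open>r = k\<close> by simp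
  obtain Q' where Q': "Q' \<in> GL ?n" "Q * Q' = 1\<^sub>m ?n" using GL_inverse[OF Q] .
  have Q'c: "Q' \<in> carrier_mat ?n ?n" using Q' GL_carrier by blast
  have Fc: "F \<in> carrier_mat r r" using FG GL_carrier by blast
  define C' where "C' = (0\<^sub>m w r @\<^sub>c 1\<^sub>m w) * Q'"
  have "four_block_mat F (0\<^sub>m r w) (0\<^sub>m w r) (1\<^sub>m w) \<in> GL ?n"
    using FG Fc by (simp add: four_block_GL_upper_right_zero GL_one)
  then have "((F @\<^sub>c 0\<^sub>m r w) @\<^sub>r (0\<^sub>m w r @\<^sub>c 1\<^sub>m w)) * Q' \<in> GL ?n"
    using Q' append_rows_cols[of F r r "0\<^sub>m r w" w "0\<^sub>m w r" w "1\<^sub>m w"] Fc by (simp add: GL_mult)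
  also have "((F @\<^sub>c 0\<^sub>m r w) @\<^sub>r (0\<^sub>m w r @\<^sub>c 1\<^sub>m w)) * Q' = ((F @\<^sub>c 0\<^sub>m r w) * Q') @\<^sub>r C'"
    unfolding C'_def using Fc Q'c by (intro append_rows_mult[of _ r ?n _ w]) auto
  also have "(F @\<^sub>c 0\<^sub>m r w) * Q' = C"
    unfolding CQ[symmetric] using Cc Q' Qc Q'c by simp
  finally have "C @\<^sub>r C' \<in> GL ?n" .
  moreover have "C' \<in> carrier_mat w ?n"
    unfolding C'_def by (rule mult_carrier_mat[OF _ Q'c]) auto
  ultimately show ?thesis using that by blast
qed

text \<open>Relative to a basis that starts with the rows of \<open>C\<close>, a completion is a block \<open>X @\<^sub>c Y\<close> with
  \<open>X\<close> arbitrary and \<open>Y\<close> invertible.\<close>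

lemma card_completions:
  assumes C: "(C :: 'a :: {field, finite} mat) \<in> full_row_rank r (r + w)"
  shows "card {C' \<in> carrier_mat w (r + w). C @\<^sub>r C' \<in> GL (r + w)}
    = CARD('a) ^ (w * r) * card (GL w :: 'a mat set)"
proof -
  let ?n = "r + w"
  obtain C0 where C0: "C0 \<in> carrier_mat w ?n" and G: "C @\<^sub>r C0 \<in> GL ?n"
    by (rule full_row_rank_completion[OF C])
  define S where "S = C @\<^sub>r C0"
  have S: "S \<in> GL ?n" using G by (simp add: S_def)
  have Sc: "S \<in> carrier_mat ?n ?n" using S GL_carrier by blast
  have Cc: "C \<in> carrier_mat r ?n" using C by (rule full_row_rank_carrier)
  have CS: "C = (1\<^sub>m r @\<^sub>c 0\<^sub>m r w) * S"
    unfolding S_def using Cc C0 by (simp add: projection_mult_append_rows)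
  have eq: "C @\<^sub>r ((X @\<^sub>c Y) * S) = four_block_mat (1\<^sub>m r) (0\<^sub>m r w) X Y * S"
    if "X \<in> carrier_mat w r" "Y \<in> carrier_mat w w" for X Y
    using that Sc append_rows_mult[of "1\<^sub>m r @\<^sub>c 0\<^sub>m r w" r ?n "X @\<^sub>c Y" w S ?n]
      append_rows_cols[of "1\<^sub>m r" r r "0\<^sub>m r w" w X w Y]
    by (subst CS) auto
  have iff: "C @\<^sub>r ((X @\<^sub>c Y) * S) \<in> GL ?n \<longleftrightarrow> Y \<in> GL w"
    if X: "X \<in> carrier_mat w r" and Y: "Y \<in> carrier_mat w w" for X Y
  proof -
    have "C @\<^sub>r ((X @\<^sub>c Y) * S) \<in> GL ?n \<longleftrightarrow> four_block_mat (1\<^sub>m r) (0\<^sub>m r w) X Y \<in> GL ?n"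
      unfolding eq[OF X Y]
      using full_row_rank_GL_iff(2)[OF GL_one S four_block_carrier_mat[OF one_carrier_mat Y]]
      by (simp only: full_row_rank_square)
    then show ?thesis using X Y by (simp add: four_block_GL_upper_right_zero GL_one)
  qed
  have "bij_betw (\<lambda>(X, Y). (X @\<^sub>c Y) * S) (carrier_mat w r \<times> GL w)
    {C' \<in> carrier_mat w ?n. C @\<^sub>r C' \<in> GL ?n}"
  proof (rule bij_betw_imageI)
    show "inj_on (\<lambda>(X, Y). (X @\<^sub>c Y) * S) (carrier_mat w r \<times> GL w)"
    proof (rule inj_onI, clarify)
      fix X Y X' Y'
      assume X: "X \<in> carrier_mat w r" "X' \<in> carrier_mat w r" and Y: "Y \<in> GL w" "Y' \<in> GL w"
        and e: "(X @\<^sub>c Y) * S = (X' @\<^sub>c Y') * S"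
      have Yc: "Y \<in> carrier_mat w w" "Y' \<in> carrier_mat w w" using Y GL_carrier by auto
      have "X @\<^sub>c Y = X' @\<^sub>c Y'"
        using e X Yc by (subst (asm) GL_mult_right_cancel[OF S]) auto
      then show "X = X' \<and> Y = Y'" using append_cols_eq_iff[of X w r X' Y w Y'] X Yc by simp
    qed
    show "(\<lambda>(X, Y). (X @\<^sub>c Y) * S) ` (carrier_mat w r \<times> GL w)
        = {C' \<in> carrier_mat w ?n. C @\<^sub>r C' \<in> GL ?n}"
    proof (intro equalityI subsetI)
      fix M assume "M \<in> (\<lambda>(X, Y). (X @\<^sub>c Y) * S) ` (carrier_mat w r \<times> GL w)"
      then obtain X Y where X: "X \<in> carrier_mat w r" and Y: "Y \<in> GL w" and M: "M = (X @\<^sub>c Y) * S"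
        by auto
      show "M \<in> {C' \<in> carrier_mat w ?n. C @\<^sub>r C' \<in> GL ?n}"
        using iff[OF X GL_carrier[OF Y]] X Y GL_carrier[OF Y]
          mult_carrier_mat[OF carrier_append_cols[OF X GL_carrier[OF Y]] Sc]
        by (simp add: M)
    next
      fix M assume "M \<in> {C' \<in> carrier_mat w ?n. C @\<^sub>r C' \<in> GL ?n}"
      then have Mc: "M \<in> carrier_mat w ?n" and MG: "C @\<^sub>r M \<in> GL ?n" by auto
      obtain S' where S': "S' \<in> GL ?n" "S' * S = 1\<^sub>m ?n" using GL_inverse[OF S] .
      have S'c: "S' \<in> carrier_mat ?n ?n" using S' GL_carrier by blast
      obtain X Y where X: "X \<in> carrier_mat w r" and Y: "Y \<in> carrier_mat w w"
        and MS: "M * S' = X @\<^sub>c Y"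
        using append_cols_split[of "M * S'" w r w] Mc S'c by auto
      have "M = (X @\<^sub>c Y) * S" unfolding MS[symmetric] using Mc Sc S'c S' by simp
      with MG iff[OF X Y] X show "M \<in> (\<lambda>(X, Y). (X @\<^sub>c Y) * S) ` (carrier_mat w r \<times> GL w)"
        by auto
    qed
  qed
  from bij_betw_same_card[OF this] show ?thesis by (simp add: card_cartesian_product card_carrier_mat)
qed

lemma finite_full_row_rank [simp]: "finite (full_row_rank r n :: 'a :: {field, finite} mat set)"
  by (rule finite_subset[OF _ finite_carrier_mat[of r n]]) (auto simp: full_row_rank_def)

text \<open>An invertible matrix is a matrix of full row rank followed by one of its completions.\<close>

lemma card_GL_eq_card_full_row_rank:
  "card (GL (r + w) :: 'a :: {field, finite} mat set)
    = card (full_row_rank r (r + w) :: 'a mat set) * (CARD('a) ^ (w * r) * card (GL w :: 'a mat set))"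
proof -
  let ?n = "r + w"
  let ?K = "\<lambda>C :: 'a mat. {C' \<in> carrier_mat w ?n. C @\<^sub>r C' \<in> GL ?n}"
  have "bij_betw (\<lambda>(C, C'). C @\<^sub>r C') (Sigma (full_row_rank r ?n) ?K) (GL ?n)"
  proof (rule bij_betw_imageI)
    show "inj_on (\<lambda>(C, C'). C @\<^sub>r C') (Sigma (full_row_rank r ?n) ?K)"
    proof (rule inj_onI, clarify)
      fix C C' D D' :: "'a mat"
      assume "C \<in> full_row_rank r ?n" "D \<in> full_row_rank r ?n"
        and "C' \<in> carrier_mat w ?n" "D' \<in> carrier_mat w ?n" and "C @\<^sub>r C' = D @\<^sub>r D'"
      then show "C = D \<and> C' = D'"
        using append_rows_eq_iff[of C r ?n D C' w D'] full_row_rank_carrier by blast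
    qed
    show "(\<lambda>(C, C'). C @\<^sub>r C') ` Sigma (full_row_rank r ?n) ?K = GL ?n"
    proof (intro equalityI subsetI)
      fix M :: "'a mat" assume M: "M \<in> GL ?n"
      obtain C C' where CC: "C \<in> carrier_mat r ?n" "C' \<in> carrier_mat w ?n" "M = C @\<^sub>r C'"
        by (rule append_rows_split[OF GL_carrier[OF M]])
      moreover have "C \<in> full_row_rank r ?n"
        using GL_top_rows_full_row_rank[of C C' r w] CC M by simp
      ultimately show "M \<in> (\<lambda>(C, C'). C @\<^sub>r C') ` Sigma (full_row_rank r ?n) ?K"
        using M by (auto intro!: image_eqI[of _ _ "(C, C')"])
    qed auto
  qed
  then have "card (GL ?n :: 'a mat set) = card (Sigma (full_row_rank r ?n) ?K)"
    by (rule bij_betw_same_card[symmetric])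
  also have "\<dots> = (\<Sum>C\<in>full_row_rank r ?n. card (?K C))"
    by (rule card_SigmaI) auto
  also have "\<dots> = (\<Sum>C\<in>(full_row_rank r ?n :: 'a mat set). CARD('a) ^ (w * r) * card (GL w :: 'a mat set))"
    by (intro sum.cong card_completions) auto
  finally show ?thesis by simp
qed

text \<open>A system of linear equations of full row rank has an affine space of solutions.\<close>

lemma card_solutions_full_row_rank:
  assumes C: "(C :: 'a :: {field, finite} mat) \<in> full_row_rank r (r + w)" and Y: "Y \<in> carrier_mat r k"
  shows "card {Z \<in> carrier_mat (r + w) k. C * Z = Y} = CARD('a) ^ (w * k)"
proof -
  let ?n = "r + w"
  obtain C' where C': "C' \<in> carrier_mat w ?n" and S: "C @\<^sub>r C' \<in> GL ?n"
    by (rule full_row_rank_completion[OF C])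
  have Cc: "C \<in> carrier_mat r ?n" using C by (rule full_row_rank_carrier)
  obtain S' where S': "S' \<in> GL ?n" "(C @\<^sub>r C') * S' = 1\<^sub>m ?n" "S' * (C @\<^sub>r C') = 1\<^sub>m ?n"
    using GL_inverse[OF S] .
  have S'c: "S' \<in> carrier_mat ?n ?n" and Sc: "C @\<^sub>r C' \<in> carrier_mat ?n ?n"
    using S' S GL_carrier by auto
  have "bij_betw (\<lambda>Z. C' * Z) {Z \<in> carrier_mat ?n k. C * Z = Y} (carrier_mat w k)"
  proof (rule bij_betwI[where g = "\<lambda>U. S' * (Y @\<^sub>r U)"])
    show "(\<lambda>Z. C' * Z) \<in> {Z \<in> carrier_mat ?n k. C * Z = Y} \<rightarrow> carrier_mat w k"
      using C' by auto
  next
    fix Z assume "Z \<in> {Z \<in> carrier_mat ?n k. C * Z = Y}"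
    then have Z: "Z \<in> carrier_mat ?n k" and "C * Z = Y" by auto
    then have "Y @\<^sub>r (C' * Z) = (C @\<^sub>r C') * Z" using Cc C' by (simp add: append_rows_mult)
    then show "S' * (Y @\<^sub>r (C' * Z)) = Z"
      using Z S'c Sc S' by (simp flip: assoc_mult_mat[of S' ?n ?n "C @\<^sub>r C'" ?n])
  next
    have "C * (S' * (Y @\<^sub>r U)) = Y \<and> C' * (S' * (Y @\<^sub>r U)) = U" if U: "U \<in> carrier_mat w k" for U
    proof -
      have YU: "Y @\<^sub>r U \<in> carrier_mat ?n k" using Y U by auto
      have "(C @\<^sub>r C') * (S' * (Y @\<^sub>r U)) = Y @\<^sub>r U"
        using S' S'c Sc YU by (simp flip: assoc_mult_mat[of "C @\<^sub>r C'" ?n ?n S' ?n])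
      moreover have "(C @\<^sub>r C') * (S' * (Y @\<^sub>r U)) = (C * (S' * (Y @\<^sub>r U))) @\<^sub>r (C' * (S' * (Y @\<^sub>r U)))"
        using append_rows_mult[OF Cc C' mult_carrier_mat[OF S'c YU]] .
      ultimately show ?thesis
        using append_rows_eq_iff[of _ r k Y _ w U] Y U Cc C' mult_carrier_mat[OF S'c YU]
        by (metis mult_carrier_mat)
    qed
    then show "(\<lambda>U. S' * (Y @\<^sub>r U)) \<in> carrier_mat w k \<rightarrow> {Z \<in> carrier_mat ?n k. C * Z = Y}"
      and "\<And>U. U \<in> carrier_mat w k \<Longrightarrow> C' * (S' * (Y @\<^sub>r U)) = U"
      using S'c Y by auto
  qed
  then show ?thesis by (simp add: bij_betw_same_card card_carrier_mat)
qed

section \<open>Row reduction and rank\<close>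

text \<open>The changes of basis of the target after which a matrix with \<open>r + w\<close> rows consists of
  \<open>r\<close> independent rows followed by \<open>w\<close> zero rows.\<close>

definition row_reductions :: "nat \<Rightarrow> nat \<Rightarrow> nat \<Rightarrow> 'a :: field mat \<Rightarrow> 'a mat set" where
  "row_reductions r w n A = {R \<in> GL (r + w). \<exists>C \<in> full_row_rank r n. R * A = C @\<^sub>r 0\<^sub>m w n}"

text \<open>A relational form of the rank of a matrix with \<open>m\<close> rows and \<open>n\<close> columns; existence and
  uniqueness of \<open>r\<close> are proved below.\<close>

definition has_rank :: "nat \<Rightarrow> nat \<Rightarrow> 'a :: field mat \<Rightarrow> nat \<Rightarrow> bool" where
  "has_rank m n A r \<longleftrightarrow> r \<le> m \<and> row_reductions r (m - r) n A \<noteq> {}"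

lemma has_rank_exists:
  assumes "(A :: 'a :: field mat) \<in> carrier_mat m n"
  obtains r where "has_rank m n A r"
proof -
  obtain R r C where R: "R \<in> GL m" "r \<le> m" "C \<in> full_row_rank r n" "R * A = C @\<^sub>r 0\<^sub>m (m - r) n"
    by (rule echelon_form_exists[OF assms])
  then have "R \<in> row_reductions r (m - r) n A" by (auto simp: row_reductions_def)
  then show ?thesis using that[of r] R(2) by (auto simp: has_rank_def)
qed

lemma rank_le_rank:
  fixes A :: "'a :: {field, finite} mat"
  assumes A: "A \<in> carrier_mat m n" and r: "has_rank m n A r" and s: "has_rank m n A s"
  shows "r \<le> s"
proof -
  from r obtain R C where rm: "r \<le> m" and R: "R \<in> GL m" and C: "C \<in> full_row_rank r n"
    and RA: "R * A = C @\<^sub>r 0\<^sub>m (m - r) n" by (auto simp: has_rank_def row_reductions_def)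
  from s obtain S D where sm: "s \<le> m" and S: "S \<in> GL m" and D: "D \<in> full_row_rank s n"
    and SA: "S * A = D @\<^sub>r 0\<^sub>m (m - s) n" by (auto simp: has_rank_def row_reductions_def)
  obtain S' where S': "S' \<in> GL m" "S' * S = 1\<^sub>m m" using GL_inverse[OF S] .
  note c = GL_carrier[OF R] GL_carrier[OF S] GL_carrier[OF S'(1)]
    full_row_rank_carrier[OF C] full_row_rank_carrier[OF D]
  have RS: "R * S' \<in> carrier_mat (r + (m - r)) m" using c rm by simp
  obtain T U where T: "T \<in> carrier_mat r m" and U: "U \<in> carrier_mat (m - r) m" and TU: "R * S' = T @\<^sub>r U"
    by (rule append_rows_split[OF RS])
  obtain X Y where X: "X \<in> carrier_mat r s" and Y: "Y \<in> carrier_mat r (m - s)" and XY: "T = X @\<^sub>c Y"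
    using append_cols_split[of T r s "m - s"] T sm by auto
  let ?M = "D @\<^sub>r 0\<^sub>m (m - s) n"
  have M: "?M \<in> carrier_mat m n" using carrier_append_rows[OF c(5) zero_carrier_mat, of "m - s"] sm by simp
  have "C @\<^sub>r 0\<^sub>m (m - r) n = R * A" by (simp add: RA)
  also have "R * A = (R * S') * (S * A)"
  proof -
    have "S' * (S * A) = A" using c A S' by (simp flip: assoc_mult_mat[of S' m m S m])
    then show ?thesis using assoc_mult_mat[OF c(1,3), of "S * A" n] c A by simp
  qed
  also have "\<dots> = (T @\<^sub>r U) * ?M" by (simp add: TU SA)
  also have "\<dots> = T * ?M @\<^sub>r U * ?M" by (rule append_rows_mult[OF T U M])
  finally have "C = T * ?M"
    using append_rows_eq_iff[of C r n "T * ?M" "0\<^sub>m (m - r) n" "m - r" "U * ?M"] c T U M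
    by (metis mult_carrier_mat zero_carrier_mat)
  also have "T * ?M = X * D"
    unfolding XY using append_cols_mult_append_rows[OF X Y c(5) zero_carrier_mat] X Y c(5) by simp
  finally have "X \<in> full_row_rank r s" using full_row_rank_right_factor[of X D r n s] C X c(5) by simp
  then show ?thesis by (rule full_row_rank_le)
qed

lemma has_rank_unique:
  fixes A :: "'a :: {field, finite} mat"
  assumes "A \<in> carrier_mat m n" "has_rank m n A r" "has_rank m n A s"
  shows "r = s"
  using assms by (metis rank_le_rank le_antisym)

lemma card_row_reductions:
  fixes A :: "'a :: {field, finite} mat"
  assumes A: "A \<in> carrier_mat (r + w) n" and rank: "has_rank (r + w) n A r"
  shows "card (row_reductions r w n A)
    = card (GL r :: 'a mat set) * (CARD('a) ^ (r * w) * card (GL w :: 'a mat set))"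
proof -
  let ?m = "r + w"
  from rank obtain R C where R: "R \<in> GL ?m" and C: "C \<in> full_row_rank r n"
    and RA: "R * A = C @\<^sub>r 0\<^sub>m w n" by (auto simp: has_rank_def row_reductions_def)
  obtain R' where R': "R' \<in> GL ?m" "R * R' = 1\<^sub>m ?m" "R' * R = 1\<^sub>m ?m" using GL_inverse[OF R] .
  from C obtain D where D: "D \<in> carrier_mat n r" "C * D = 1\<^sub>m r" by (auto simp: full_row_rank_def)
  note c = GL_carrier[OF R] GL_carrier[OF R'(1)] full_row_rank_carrier[OF C]
  define \<Phi> where "\<Phi> = (\<lambda>(X, Y, Z). four_block_mat X Y (0\<^sub>m w r) Z * R)"
  \<comment> \<open>The other reductions differ from \<open>R\<close> by an element of the stabiliser of the span of the
    first \<open>r\<close> coordinates.\<close>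
  have prod: "four_block_mat X Y V Z * (C @\<^sub>r 0\<^sub>m w n) = (X * C) @\<^sub>r (V * C)"
    if "X \<in> carrier_mat r r" "Y \<in> carrier_mat r w" "V \<in> carrier_mat w r" "Z \<in> carrier_mat w w" for X Y V Z
  proof -
    have "four_block_mat X Y V Z * (C @\<^sub>r 0\<^sub>m w n)
        = ((X @\<^sub>c Y) * (C @\<^sub>r 0\<^sub>m w n)) @\<^sub>r ((V @\<^sub>c Z) * (C @\<^sub>r 0\<^sub>m w n))"
      unfolding append_rows_cols[OF that, symmetric]
      by (rule append_rows_mult[OF carrier_append_cols[OF that(1,2)] carrier_append_cols[OF that(3,4)]
            carrier_append_rows[OF c(3) zero_carrier_mat]])
    then show ?thesis
      using append_cols_mult_append_rows[OF that(1,2) c(3) zero_carrier_mat]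
        append_cols_mult_append_rows[OF that(3,4) c(3) zero_carrier_mat] that c by simp
  qed
  have act: "(S * R) * A = S * (C @\<^sub>r 0\<^sub>m w n)" if "S \<in> carrier_mat ?m ?m" for S
    using that c A by (simp flip: RA)
  have "bij_betw \<Phi> (GL r \<times> carrier_mat r w \<times> GL w) (row_reductions r w n A)"
  proof (rule bij_betw_imageI)
    show "inj_on \<Phi> (GL r \<times> carrier_mat r w \<times> GL w)"
    proof (rule inj_onI)
      fix p p' assume "p \<in> GL r \<times> carrier_mat r w \<times> GL w" "p' \<in> GL r \<times> carrier_mat r w \<times> GL w"
        and e: "\<Phi> p = \<Phi> p'"
      then obtain X Y Z X' Y' Z' where p: "p = (X, Y, Z)" "p' = (X', Y', Z')"
        and X: "X \<in> GL r" "X' \<in> GL r" and Y: "Y \<in> carrier_mat r w" "Y' \<in> carrier_mat r w"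
        and Z: "Z \<in> GL w" "Z' \<in> GL w" by auto
      note d = GL_carrier[OF X(1)] GL_carrier[OF X(2)] GL_carrier[OF Z(1)] GL_carrier[OF Z(2)]
      let ?O = "0\<^sub>m w r :: 'a mat"
      have "four_block_mat X Y ?O Z = four_block_mat X' Y' ?O Z'"
        using e d Y GL_mult_right_cancel[OF R four_block_carrier_mat[OF d(1,3)] four_block_carrier_mat[OF d(2,4)]]
        by (simp add: \<Phi>_def p)
      then have "(X @\<^sub>c Y) @\<^sub>r (?O @\<^sub>c Z) = (X' @\<^sub>c Y') @\<^sub>r (?O @\<^sub>c Z')"
        using append_rows_cols[of X r r Y w ?O w Z] append_rows_cols[of X' r r Y' w ?O w Z'] d Y by simp
      then have "X @\<^sub>c Y = X' @\<^sub>c Y' \<and> ?O @\<^sub>c Z = ?O @\<^sub>c Z'"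
        using append_rows_eq_iff[of "X @\<^sub>c Y" r ?m "X' @\<^sub>c Y'" "?O @\<^sub>c Z" w "?O @\<^sub>c Z'"] d Y by simp
      then show "p = p'"
        using append_cols_eq_iff[of X r r X' Y w Y'] append_cols_eq_iff[of ?O w r ?O Z w Z'] d Y
        by (simp add: p)
    qed
    show "\<Phi> ` (GL r \<times> carrier_mat r w \<times> GL w) = row_reductions r w n A"
    proof (intro equalityI subsetI)
      fix M assume "M \<in> \<Phi> ` (GL r \<times> carrier_mat r w \<times> GL w)"
      then obtain X Y Z where X: "X \<in> GL r" and Y: "Y \<in> carrier_mat r w" and Z: "Z \<in> GL w"
        and M: "M = four_block_mat X Y (0\<^sub>m w r) Z * R" by (auto simp: \<Phi>_def)
      note d = GL_carrier[OF X] GL_carrier[OF Z]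
      have G: "four_block_mat X Y (0\<^sub>m w r) Z \<in> GL ?m"
        using X Z d Y by (simp add: four_block_GL_lower_left_zero)
      have "M * A = (X * C) @\<^sub>r (0\<^sub>m w r * C)"
        unfolding M by (subst act[OF GL_carrier[OF G]]) (rule prod[OF d(1) Y _ d(2)], simp)
      moreover have "X * C \<in> full_row_rank r n" using full_row_rank_GL_iff(1)[OF X GL_one c(3)] C by simp
      moreover have "M \<in> GL ?m" unfolding M using G R by (rule GL_mult)
      ultimately show "M \<in> row_reductions r w n A"
        using c(3) by (auto simp: row_reductions_def)
    next
      fix M assume "M \<in> row_reductions r w n A"
      then obtain E where M: "M \<in> GL ?m" and E: "E \<in> full_row_rank r n"
        and MA: "M * A = E @\<^sub>r 0\<^sub>m w n" by (auto simp: row_reductions_def)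
      define S where "S = M * R'"
      have S: "S \<in> GL ?m" unfolding S_def using M R'(1) by (rule GL_mult)
      have MS: "M = S * R" unfolding S_def using GL_carrier[OF M] c R' by simp
      obtain X Y V Z where XYVZ: "split_block S r r = (X, Y, V, Z)" by (metis prod_cases4)
      have dimS: "dim_row S = r + w" "dim_col S = r + w" using GL_carrier[OF S] by auto
      note b = split_block[OF XYVZ dimS]
      have "E @\<^sub>r 0\<^sub>m w n = (X * C) @\<^sub>r (V * C)"
        using prod[OF b(1-4)] act[OF GL_carrier[OF S]] MA unfolding MS b(5) by simp
      then have "V * C = 0\<^sub>m w n"
        using append_rows_eq_iff[of E r n "X * C" "0\<^sub>m w n" w "V * C"] b c full_row_rank_carrier[OF E] by simp
      moreover have "V = (V * C) * D" using b(3) c(3) D by simp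
      ultimately have V: "V = 0\<^sub>m w r" using D by simp
      have "X \<in> GL r \<and> Z \<in> GL w"
        using S b(1,2,4) unfolding b(5) V by (simp add: four_block_GL_lower_left_zero)
      then show "M \<in> \<Phi> ` (GL r \<times> carrier_mat r w \<times> GL w)"
        using b(2) b(5) MS V by (auto simp: \<Phi>_def intro!: image_eqI[of _ _ "(X, Y, Z)"])
    qed
  qed
  from bij_betw_same_card[OF this] show ?thesis by (simp add: card_cartesian_product card_carrier_mat)
qed

lemma block_full_row_rank_iff:
  fixes C :: "'a :: field mat"
  assumes C: "C \<in> full_row_rank s n" and a: "a1 \<in> carrier_mat s w" "a2 \<in> carrier_mat k w"
  shows "four_block_mat C a1 (0\<^sub>m k n) a2 \<in> full_row_rank (s + k) (n + w) \<longleftrightarrow> a2 \<in> full_row_rank k w"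
    (is "?M \<in> _ \<longleftrightarrow> _")
proof
  have Cc: "C \<in> carrier_mat s n" using C by (rule full_row_rank_carrier)
  have Mc: "?M \<in> carrier_mat (s + k) (n + w)" using Cc a by simp
  {
    assume M: "?M \<in> full_row_rank (s + k) (n + w)"
    have "?M = (C @\<^sub>c a1) @\<^sub>r (0\<^sub>m k n @\<^sub>c a2)"
      by (rule append_rows_cols[symmetric, OF Cc a(1) zero_carrier_mat a(2)])
    then have "(0\<^sub>m k s @\<^sub>c 1\<^sub>m k) * ?M = 0\<^sub>m k n @\<^sub>c a2"
      using projection_mult_append_rows(2)[of "C @\<^sub>c a1" s "n + w" "0\<^sub>m k n @\<^sub>c a2" k] Cc a by simp
    moreover have "(0\<^sub>m k s @\<^sub>c 1\<^sub>m k) * ?M \<in> full_row_rank k (n + w)"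
      using projection_full_row_rank(2) M by (rule full_row_rank_mult)
    moreover have "a2 * (0\<^sub>m w n @\<^sub>c 1\<^sub>m w) = 0\<^sub>m k n @\<^sub>c a2"
      using mult_append_cols[of "0\<^sub>m w n" w n "1\<^sub>m w" w a2 k] a by simp
    ultimately show "a2 \<in> full_row_rank k w"
      using full_row_rank_right_factor[of a2 "0\<^sub>m w n @\<^sub>c 1\<^sub>m w" k "n + w" w] a by simp
  }
  {
    assume "a2 \<in> full_row_rank k w"
    then obtain d where d: "d \<in> carrier_mat w k" "a2 * d = 1\<^sub>m k" by (auto simp: full_row_rank_def)
    from C obtain D where D: "D \<in> carrier_mat n s" "C * D = 1\<^sub>m s" by (auto simp: full_row_rank_def)
    \<comment> \<open>The upper right block cancels the contribution of \<open>a1\<close>.\<close>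
    let ?N = "four_block_mat D (- (D * (a1 * d))) (0\<^sub>m w s) d"
    have ad: "a1 * d \<in> carrier_mat s k" using a d by simp
    have "C * (- (D * (a1 * d))) = - (C * (D * (a1 * d)))"
      using Cc D ad by (intro eq_matI) auto
    also have "C * (D * (a1 * d)) = a1 * d"
      using Cc D left_mult_one_mat[OF ad] ad by (simp flip: assoc_mult_mat[of C s n D s])
    finally have e: "C * (- (D * (a1 * d))) + a1 * d = 0\<^sub>m s k"
      using ad by (simp add: uminus_l_inv_mat)
    have "?M * ?N = four_block_mat (C * D + a1 * 0\<^sub>m w s) (C * (- (D * (a1 * d))) + a1 * d)
        (0\<^sub>m k n * D + a2 * 0\<^sub>m w s) (0\<^sub>m k n * (- (D * (a1 * d))) + a2 * d)"
      using Cc a D d ad by (intro mult_four_block_mat) auto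
    also have "\<dots> = four_block_mat (1\<^sub>m s) (0\<^sub>m s k) (0\<^sub>m k s) (1\<^sub>m k)"
      unfolding e using Cc a D d ad by (intro cong_four_block_mat) auto
    also have "\<dots> = 1\<^sub>m (s + k)" by simp
    finally show "?M \<in> full_row_rank (s + k) (n + w)"
      using Mc D d ad by (intro full_row_rankI[of _ _ _ ?N]) auto
  }
qed

text \<open>The column blocks that extend a matrix of rank \<open>s\<close> with \<open>m\<close> rows to a matrix of full row
  rank: modulo the column space of the matrix, such a block is a surjection onto a space of
  dimension \<open>m - s\<close>.\<close>

lemma card_full_row_rank_extensions:
  fixes A :: "'a :: {field, finite} mat"
  assumes A: "A \<in> carrier_mat m n" and rank: "has_rank m n A s"
  shows "card {\<alpha> \<in> carrier_mat m w. A @\<^sub>c \<alpha> \<in> full_row_rank m (n + w)}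
    = CARD('a) ^ (s * w) * card (full_row_rank (m - s) w :: 'a mat set)"
proof -
  define k where "k = m - s"
  from rank have m: "m = s + k" by (simp add: has_rank_def k_def)
  from rank obtain R C where R: "R \<in> GL m" and C: "C \<in> full_row_rank s n"
    and RA: "R * A = C @\<^sub>r 0\<^sub>m k n" by (auto simp: has_rank_def row_reductions_def k_def)
  obtain R' where R': "R' \<in> GL m" "R * R' = 1\<^sub>m m" "R' * R = 1\<^sub>m m" using GL_inverse[OF R] .
  note c = GL_carrier[OF R] GL_carrier[OF R'(1)] full_row_rank_carrier[OF C]
  have inv: "R' * (R * M) = M" "R * (R' * M) = M" if "M \<in> carrier_mat m w" for M
    using that c R' by (simp_all flip: assoc_mult_mat[of R' m m R m] assoc_mult_mat[of R m m R' m])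
  have iff: "A @\<^sub>c \<alpha> \<in> full_row_rank m (n + w) \<longleftrightarrow> a2 \<in> full_row_rank k w"
    if \<alpha>: "\<alpha> \<in> carrier_mat m w" and a: "a1 \<in> carrier_mat s w" "a2 \<in> carrier_mat k w"
      and R\<alpha>: "R * \<alpha> = a1 @\<^sub>r a2" for \<alpha> a1 a2
  proof -
    have "A @\<^sub>c \<alpha> \<in> full_row_rank m (n + w) \<longleftrightarrow> R * (A @\<^sub>c \<alpha>) \<in> full_row_rank m (n + w)"
      using full_row_rank_GL_iff(1)[OF R GL_one] A \<alpha> by simp
    also have "R * (A @\<^sub>c \<alpha>) = (C @\<^sub>r 0\<^sub>m k n) @\<^sub>c (a1 @\<^sub>r a2)"
      using mult_append_cols[OF A \<alpha> c(1)] by (simp add: RA R\<alpha>)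
    also have "\<dots> = four_block_mat C a1 (0\<^sub>m k n) a2"
      using c(3) a by (intro eq_matI) (auto simp: append_rows_def append_cols_def)
    finally show ?thesis using block_full_row_rank_iff[OF C a] by (simp add: m)
  qed
  have "bij_betw (\<lambda>(a1, a2). R' * (a1 @\<^sub>r a2)) (carrier_mat s w \<times> full_row_rank k w)
    {\<alpha> \<in> carrier_mat m w. A @\<^sub>c \<alpha> \<in> full_row_rank m (n + w)}"
  proof (rule bij_betw_imageI)
    show "inj_on (\<lambda>(a1, a2). R' * (a1 @\<^sub>r a2)) (carrier_mat s w \<times> full_row_rank k w)"
    proof (rule inj_onI, clarify)
      fix a1 a2 b1 b2 assume a: "a1 \<in> carrier_mat s w" "b1 \<in> carrier_mat s w"
        and "a2 \<in> full_row_rank k w" "b2 \<in> full_row_rank k w"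
        and e: "R' * (a1 @\<^sub>r a2) = R' * (b1 @\<^sub>r b2)"
      then have b: "a2 \<in> carrier_mat k w" "b2 \<in> carrier_mat k w" by (auto dest: full_row_rank_carrier)
      have "a1 @\<^sub>r a2 = b1 @\<^sub>r b2"
        using e GL_mult_left_cancel[OF R'(1), of "a1 @\<^sub>r a2" w "b1 @\<^sub>r b2"] a b by (simp add: m)
      then show "a1 = b1 \<and> a2 = b2" using append_rows_eq_iff[OF a b] by simp
    qed
    show "(\<lambda>(a1, a2). R' * (a1 @\<^sub>r a2)) ` (carrier_mat s w \<times> full_row_rank k w)
      = {\<alpha> \<in> carrier_mat m w. A @\<^sub>c \<alpha> \<in> full_row_rank m (n + w)}"
    proof (intro equalityI subsetI)
      fix \<alpha> assume "\<alpha> \<in> (\<lambda>(a1, a2). R' * (a1 @\<^sub>r a2)) ` (carrier_mat s w \<times> full_row_rank k w)"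
      then obtain a1 a2 where a: "a1 \<in> carrier_mat s w" "a2 \<in> full_row_rank k w"
        and \<alpha>: "\<alpha> = R' * (a1 @\<^sub>r a2)" by auto
      have a2: "a2 \<in> carrier_mat k w" using a(2) by (rule full_row_rank_carrier)
      then have aa: "a1 @\<^sub>r a2 \<in> carrier_mat m w" using a by (simp add: m)
      then have \<alpha>c: "\<alpha> \<in> carrier_mat m w" using c \<alpha> by simp
      from iff[OF \<alpha>c a(1) a2] inv(2)[OF aa] a(2) \<alpha>c
      show "\<alpha> \<in> {\<alpha> \<in> carrier_mat m w. A @\<^sub>c \<alpha> \<in> full_row_rank m (n + w)}" by (simp add: \<alpha>)
    next
      fix \<alpha> assume "\<alpha> \<in> {\<alpha> \<in> carrier_mat m w. A @\<^sub>c \<alpha> \<in> full_row_rank m (n + w)}"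
      then have \<alpha>: "\<alpha> \<in> carrier_mat m w" "A @\<^sub>c \<alpha> \<in> full_row_rank m (n + w)" by auto
      have "R * \<alpha> \<in> carrier_mat (s + k) w" using \<alpha> c(1) by (simp add: m)
      then obtain a1 a2 where a: "a1 \<in> carrier_mat s w" "a2 \<in> carrier_mat k w" "R * \<alpha> = a1 @\<^sub>r a2"
        by (rule append_rows_split)
      have "a2 \<in> full_row_rank k w" using iff[OF \<alpha>(1) a] \<alpha>(2) by simp
      moreover have "\<alpha> = R' * (a1 @\<^sub>r a2)" using inv(1)[OF \<alpha>(1)] a(3) by simp
      ultimately show "\<alpha> \<in> (\<lambda>(a1, a2). R' * (a1 @\<^sub>r a2)) ` (carrier_mat s w \<times> full_row_rank k w)"
        using a(1) by auto
    qed
  qed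
  from bij_betw_same_card[OF this] show ?thesis
    by (simp add: card_cartesian_product card_carrier_mat k_def)
qed

section \<open>Commuting pairs with a given rank\<close>

abbreviation comm_pairs :: "nat \<Rightarrow> nat \<Rightarrow> ('a :: field mat \<times> 'a mat) set" where
  "comm_pairs b n \<equiv> commuting_nilp_pairs TYPE('a) b n"

text \<open>The commuting pairs \<open>(A, B)\<close> of size \<open>n\<close> with \<open>A\<^sup>b = 0\<close> in which \<open>A\<close> has rank \<open>r\<close>.\<close>

definition comm_pairs_of_rank :: "nat \<Rightarrow> nat \<Rightarrow> nat \<Rightarrow> ('a :: field mat \<times> 'a mat) set" where
  "comm_pairs_of_rank b n r = {(A, B) \<in> comm_pairs b n. has_rank n n A r}"

text \<open>The pairs in which the image of \<open>A\<close> is spanned by the first \<open>r\<close> of the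
  \<open>r + w\<close> coordinate vectors.\<close>

definition adapted_pairs :: "nat \<Rightarrow> nat \<Rightarrow> nat \<Rightarrow> ('a :: field mat \<times> 'a mat) set" where
  "adapted_pairs b r w =
    {(A, B) \<in> comm_pairs b (r + w). \<exists>C \<in> full_row_rank r (r + w). A = C @\<^sub>r 0\<^sub>m w (r + w)}"

lemma finite_comm_pairs [simp]: "finite (comm_pairs b n :: ('a :: {field, finite} mat \<times> 'a mat) set)"
  by (rule finite_subset[of _ "carrier_mat n n \<times> carrier_mat n n"])
    (auto simp: commuting_nilp_pairs_def)

lemma finite_comm_pairs_of_rank [simp]:
  "finite (comm_pairs_of_rank b n r :: ('a :: {field, finite} mat \<times> 'a mat) set)"
  by (rule finite_subset[OF _ finite_comm_pairs[of b n]]) (auto simp: comm_pairs_of_rank_def)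

lemma comm_pairs_carrier:
  "(A, B) \<in> comm_pairs b n \<Longrightarrow> A \<in> carrier_mat n n" "(A, B) \<in> comm_pairs b n \<Longrightarrow> B \<in> carrier_mat n n"
  by (auto simp: commuting_nilp_pairs_def)

lemma comm_pairs_eq_UN_rank:
  "(comm_pairs b n :: ('a :: field mat \<times> 'a mat) set) = (\<Union>r\<le>n. comm_pairs_of_rank b n r)"
proof (intro equalityI subsetI)
  fix p :: "'a mat \<times> 'a mat" assume p: "p \<in> comm_pairs b n"
  obtain A B where AB: "p = (A, B)" by (cases p)
  obtain r where "has_rank n n A r"
    using has_rank_exists[OF comm_pairs_carrier(1)] p unfolding AB by blast
  with p show "p \<in> (\<Union>r\<le>n. comm_pairs_of_rank b n r)"
    by (auto simp: AB comm_pairs_of_rank_def has_rank_def)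
qed (auto simp: comm_pairs_of_rank_def)

lemma comm_pairs_of_rank_disjoint:
  "r \<noteq> s \<Longrightarrow> comm_pairs_of_rank b n r \<inter> (comm_pairs_of_rank b n s :: ('a :: {field, finite} mat \<times> 'a mat) set) = {}"
  by (auto simp: comm_pairs_of_rank_def dest: comm_pairs_carrier has_rank_unique)

lemma conjugation_mult:
  fixes A :: "'a :: field mat"
  assumes "A \<in> carrier_mat n n" "B \<in> carrier_mat n n" "R \<in> carrier_mat n n" "R' \<in> carrier_mat n n"
    and "R' * R = 1\<^sub>m n"
  shows "(R * A * R') * (R * B * R') = R * (A * B) * R'"
proof -
  have "R' * (R * (B * R')) = B * R'"
    using assoc_mult_mat[OF assms(4,3) mult_carrier_mat[OF assms(2,4)]] assms by simp
  then show ?thesis using assms by (simp add: assoc_mult_mat[of _ n n _ n _ n])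
qed

lemma conjugation_pow:
  fixes A :: "'a :: field mat"
  assumes "A \<in> carrier_mat n n" "R \<in> carrier_mat n n" "R' \<in> carrier_mat n n"
    and "R' * R = 1\<^sub>m n" "R * R' = 1\<^sub>m n"
  shows "(R * A * R') ^\<^sub>m b = R * (A ^\<^sub>m b) * R'"
proof (induction b)
  case 0
  then show ?case using assms by simp
next
  case (Suc b)
  then show ?case using assms conjugation_mult[of "A ^\<^sub>m b" n A R R'] by simp
qed

lemma conjugation_comm_pairs:
  fixes A :: "'a :: field mat"
  assumes AB: "(A, B) \<in> comm_pairs b n" and R: "R \<in> carrier_mat n n" "R' \<in> carrier_mat n n"
    and inv: "R' * R = 1\<^sub>m n" "R * R' = 1\<^sub>m n"
  shows "(R * A * R', R * B * R') \<in> comm_pairs b n"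
proof -
  have c: "A \<in> carrier_mat n n" "B \<in> carrier_mat n n" and AB': "A * B = B * A" "A ^\<^sub>m b = 0\<^sub>m n n"
    using AB by (auto simp: commuting_nilp_pairs_def)
  have "(R * A * R') * (R * B * R') = (R * B * R') * (R * A * R')"
    using conjugation_mult[OF c R inv(1)] conjugation_mult[OF c(2,1) R inv(1)] AB' by simp
  moreover have "(R * A * R') ^\<^sub>m b = 0\<^sub>m n n"
    unfolding conjugation_pow[OF c(1) R inv] AB' using R by simp
  ultimately show ?thesis using c R by (auto simp: commuting_nilp_pairs_def)
qed

text \<open>Both sides count the pairs of rank \<open>r\<close> together with a change of basis that makes them adapted.\<close>

lemma card_comm_pairs_of_rank:
  "card (comm_pairs_of_rank b (r + w) r :: ('a :: {field, finite} mat \<times> 'a mat) set)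
      * (card (GL r :: 'a mat set) * (CARD('a) ^ (r * w) * card (GL w :: 'a mat set)))
    = card (adapted_pairs b r w :: ('a mat \<times> 'a mat) set) * card (GL (r + w) :: 'a mat set)"
proof -
  let ?n = "r + w"
  have "\<forall>R\<in>(GL ?n :: 'a mat set). \<exists>R'. R' \<in> GL ?n \<and> R * R' = 1\<^sub>m ?n \<and> R' * R = 1\<^sub>m ?n"
    using GL_inverse by metis
  then obtain J :: "'a mat \<Rightarrow> 'a mat" where J: "J R \<in> GL ?n" "R * J R = 1\<^sub>m ?n" "J R * R = 1\<^sub>m ?n"
    if "R \<in> GL ?n" for R by (metis (no_types, lifting))
  have Jc: "J R \<in> carrier_mat ?n ?n" "R \<in> carrier_mat ?n ?n" if "R \<in> GL ?n" for R
    using J(1)[OF that] that GL_carrier by auto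
  have cancel: "J R * (R * A * J R) * R = A" "R * (J R * A * R) * J R = A"
    if "R \<in> GL ?n" "A \<in> carrier_mat ?n ?n" for R A
  proof -
    note c = Jc[OF that(1)] that(2)
    have "J R * (R * A * J R) * R = (J R * R) * (A * (J R * R))"
      using c by (simp add: assoc_mult_mat[of _ ?n ?n _ ?n _ ?n])
    then show "J R * (R * A * J R) * R = A" using J[OF that(1)] c by simp
    have "R * (J R * A * R) * J R = (R * J R) * (A * (R * J R))"
      using c by (simp add: assoc_mult_mat[of _ ?n ?n _ ?n _ ?n])
    then show "R * (J R * A * R) * J R = A" using J[OF that(1)] c by simp
  qed
  let ?P = "comm_pairs_of_rank b ?n r :: ('a mat \<times> 'a mat) set"
  let ?T = "Sigma ?P (\<lambda>(A, B). row_reductions r w ?n A)"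
  let ?f = "\<lambda>((A, B), R). ((R * A * J R, R * B * J R), R)"
  let ?g = "\<lambda>((A, B), R). ((J R * A * R, J R * B * R), R)"
  have "bij_betw ?f ?T (adapted_pairs b r w \<times> GL ?n)"
  proof (rule bij_betwI[where g = ?g])
    show "?f \<in> ?T \<rightarrow> adapted_pairs b r w \<times> GL ?n"
    proof clarify
      fix A B R assume P: "(A, B) \<in> ?P" and RR: "R \<in> row_reductions r w ?n A"
      from RR obtain C where R: "R \<in> GL ?n" and C: "C \<in> full_row_rank r ?n"
        and RA: "R * A = C @\<^sub>r 0\<^sub>m w ?n" by (auto simp: row_reductions_def)
      have "R * A * J R = (C * J R) @\<^sub>r 0\<^sub>m w ?n"
        unfolding RA using append_rows_mult[OF full_row_rank_carrier[OF C] zero_carrier_mat Jc(1)[OF R]] Jc(1)[OF R]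
        by simp
      moreover have "C * J R \<in> full_row_rank r ?n"
        using full_row_rank_GL_iff(2)[OF GL_one J(1)[OF R] full_row_rank_carrier[OF C]] C by simp
      moreover have "(R * A * J R, R * B * J R) \<in> comm_pairs b ?n"
        using P Jc[OF R] J[OF R] by (intro conjugation_comm_pairs) (auto simp: comm_pairs_of_rank_def)
      ultimately show "(R * A * J R, R * B * J R) \<in> adapted_pairs b r w \<and> R \<in> GL ?n"
        using R by (auto simp: adapted_pairs_def)
    qed
    show "?g \<in> adapted_pairs b r w \<times> GL ?n \<rightarrow> ?T"
    proof clarify
      fix A B R :: "'a mat" assume AB: "(A, B) \<in> adapted_pairs b r w" and R: "R \<in> GL ?n"
      from AB obtain C where P: "(A, B) \<in> comm_pairs b ?n" and C: "C \<in> full_row_rank r ?n"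
        and AC: "A = C @\<^sub>r 0\<^sub>m w ?n" by (auto simp: adapted_pairs_def)
      note c = Jc[OF R] comm_pairs_carrier[OF P]
      have "R * (J R * A * R) = (R * J R) * (A * R)"
        using c by (simp add: assoc_mult_mat[of _ ?n ?n _ ?n _ ?n])
      also have "\<dots> = (C * R) @\<^sub>r 0\<^sub>m w ?n"
        unfolding J(2)[OF R] using c(2) append_rows_mult[OF full_row_rank_carrier[OF C] zero_carrier_mat c(2), of w]
          left_mult_one_mat[OF mult_carrier_mat[OF c(3,2)]] by (simp add: AC)
      moreover have "C * R \<in> full_row_rank r ?n"
        using full_row_rank_GL_iff(2)[OF GL_one R full_row_rank_carrier[OF C]] C by simp
      ultimately have RR: "R \<in> row_reductions r w ?n (J R * A * R)"
        using R by (auto simp: row_reductions_def)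
      moreover have "(J R * A * R, J R * B * R) \<in> comm_pairs b ?n"
        using P c J[OF R] by (intro conjugation_comm_pairs) auto
      ultimately show "(J R * A * R, J R * B * R) \<in> ?P \<and> R \<in> row_reductions r w ?n (J R * A * R)"
        by (auto simp: comm_pairs_of_rank_def has_rank_def)
    qed
    show "?g (?f x) = x" if "x \<in> ?T" for x
    proof -
      from that obtain A B R where x: "x = ((A, B), R)" and P: "(A, B) \<in> comm_pairs b ?n" and R: "R \<in> GL ?n"
        by (auto simp: comm_pairs_of_rank_def row_reductions_def)
      show ?thesis
        using cancel(1)[OF R comm_pairs_carrier(1)[OF P]] cancel(1)[OF R comm_pairs_carrier(2)[OF P]]
        by (simp add: x)
    qed
    show "?f (?g y) = y" if "y \<in> adapted_pairs b r w \<times> GL ?n" for y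
    proof -
      from that obtain A B R where y: "y = ((A, B), R)" and P: "(A, B) \<in> comm_pairs b ?n" and R: "R \<in> GL ?n"
        by (auto simp: adapted_pairs_def)
      show ?thesis
        using cancel(2)[OF R comm_pairs_carrier(1)[OF P]] cancel(2)[OF R comm_pairs_carrier(2)[OF P]]
        by (simp add: y)
    qed
  qed
  then have "card ?T = card (adapted_pairs b r w :: ('a mat \<times> 'a mat) set) * card (GL ?n :: 'a mat set)"
    by (simp add: bij_betw_same_card card_cartesian_product)
  moreover have "card ?T = (\<Sum>(A, B)\<in>?P. card (row_reductions r w ?n A))"
  proof -
    have "finite (row_reductions r w ?n (A :: 'a mat))" for A
      by (rule finite_subset[OF _ finite_GL[of ?n]]) (auto simp: row_reductions_def)
    then show ?thesis by (subst card_SigmaI) (auto intro!: sum.cong)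
  qed
  moreover have "\<dots> = (\<Sum>(A, B)\<in>?P. card (GL r :: 'a mat set) * (CARD('a) ^ (r * w) * card (GL w :: 'a mat set)))"
    by (rule sum.cong) (auto simp: comm_pairs_of_rank_def dest: comm_pairs_carrier intro!: card_row_reductions)
  ultimately show ?thesis by simp
qed

lemma append_zero_rows_pow:
  fixes A :: "'a :: field mat"
  assumes A: "A \<in> carrier_mat r r" and \<alpha>: "\<alpha> \<in> carrier_mat r w"
  shows "((A @\<^sub>c \<alpha>) @\<^sub>r 0\<^sub>m w (r + w)) ^\<^sub>m Suc b = (A ^\<^sub>m b * (A @\<^sub>c \<alpha>)) @\<^sub>r 0\<^sub>m w (r + w)"
proof (induction b)
  case 0
  have "A @\<^sub>c \<alpha> \<in> carrier_mat r (r + w)" using assms by auto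
  moreover from this have "(A @\<^sub>c \<alpha>) @\<^sub>r 0\<^sub>m w (r + w) \<in> carrier_mat (r + w) (r + w)" by auto
  ultimately show ?case using A by simp
next
  case (Suc b)
  let ?n = "r + w"
  let ?C = "A @\<^sub>c \<alpha>"
  let ?M = "?C @\<^sub>r 0\<^sub>m w ?n"
  have C: "?C \<in> carrier_mat r ?n" using assms by auto
  then have M: "?M \<in> carrier_mat ?n ?n" by auto
  have P: "A ^\<^sub>m b \<in> carrier_mat r r" using A by simp
  have "?C * ?M = A * ?C"
    using append_cols_mult_append_rows[OF A \<alpha> C zero_carrier_mat] A C \<alpha> by simp
  then have "(A ^\<^sub>m b * ?C) * ?M = A ^\<^sub>m Suc b * ?C"
    using assoc_mult_mat[OF P C M] assoc_mult_mat[OF P A C] by simp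
  moreover have "?M ^\<^sub>m Suc (Suc b) = ((A ^\<^sub>m b * ?C) * ?M) @\<^sub>r (0\<^sub>m w ?n * ?M)"
    using append_rows_mult[OF mult_carrier_mat[OF P C] zero_carrier_mat M] Suc.IH by simp
  ultimately show ?case using M by simp
qed

text \<open>An adapted pair consists of the induced pair on the image of \<open>A\<close>, the restriction
  \<open>\<alpha>\<close> of \<open>A\<close> to the remaining coordinates, and the restriction \<open>Z\<close> of \<open>B\<close> to them; the
  commutation relation on the remaining coordinates is linear in \<open>Z\<close>.\<close>

lemma adapted_block_comm_pairs_iff:
  fixes A B :: "'a :: field mat"
  assumes A: "A \<in> carrier_mat r r" and B: "B \<in> carrier_mat r r" and \<gamma>: "\<gamma> \<in> carrier_mat w r"
    and \<alpha>: "\<alpha> \<in> carrier_mat r w" and Z: "Z \<in> carrier_mat (r + w) w"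
    and C: "A @\<^sub>c \<alpha> \<in> full_row_rank r (r + w)"
  shows "((A @\<^sub>c \<alpha>) @\<^sub>r 0\<^sub>m w (r + w), (B @\<^sub>r \<gamma>) @\<^sub>c Z) \<in> comm_pairs (Suc b) (r + w)
    \<longleftrightarrow> \<gamma> = 0\<^sub>m w r \<and> (A, B) \<in> comm_pairs b r \<and> (A @\<^sub>c \<alpha>) * Z = B * \<alpha>"
proof -
  let ?n = "r + w"
  let ?C = "A @\<^sub>c \<alpha>"
  let ?M = "?C @\<^sub>r 0\<^sub>m w ?n"
  let ?N = "(B @\<^sub>r \<gamma>) @\<^sub>c Z"
  have Cc: "?C \<in> carrier_mat r ?n" using C by (rule full_row_rank_carrier)
  from C obtain D where D: "D \<in> carrier_mat ?n r" "?C * D = 1\<^sub>m r" by (auto simp: full_row_rank_def)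
  have cancel: "X * ?C = 0\<^sub>m k ?n \<longleftrightarrow> X = 0\<^sub>m k r" if X: "X \<in> carrier_mat k r" for X k
  proof
    assume "X * ?C = 0\<^sub>m k ?n"
    then have "(X * ?C) * D = 0\<^sub>m k r" using D by simp
    then show "X = 0\<^sub>m k r" using X Cc D by simp
  qed (use Cc in simp)
  have Mc: "?M \<in> carrier_mat ?n ?n" and Nc: "?N \<in> carrier_mat ?n ?n" using Cc B \<gamma> Z by auto
  have CN: "?C * ?N = (A * B + \<alpha> * \<gamma>) @\<^sub>c (?C * Z)"
    using mult_append_cols[OF carrier_append_rows[OF B \<gamma>] Z Cc] append_cols_mult_append_rows[OF A \<alpha> B \<gamma>]
    by simp
  have MN: "?M * ?N = ((A * B + \<alpha> * \<gamma>) @\<^sub>c (?C * Z)) @\<^sub>r 0\<^sub>m w ?n"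
    using append_rows_mult[OF Cc zero_carrier_mat Nc] CN Nc by simp
  have "?N * ?M = (B @\<^sub>r \<gamma>) * ?C"
    using append_cols_mult_append_rows[OF carrier_append_rows[OF B \<gamma>] Z Cc zero_carrier_mat]
      right_add_zero_mat[OF mult_carrier_mat[OF carrier_append_rows[OF B \<gamma>] Cc]] Z by simp
  also have "\<dots> = ((B * A) @\<^sub>c (B * \<alpha>)) @\<^sub>r (\<gamma> * ?C)"
    using append_rows_mult[OF B \<gamma> Cc] mult_append_cols[OF A \<alpha> B] by simp
  finally have NM: "?N * ?M = ((B * A) @\<^sub>c (B * \<alpha>)) @\<^sub>r (\<gamma> * ?C)" .
  have c: "A * B + \<alpha> * \<gamma> \<in> carrier_mat r r" "B * A \<in> carrier_mat r r" "?C * Z \<in> carrier_mat r w"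
    "B * \<alpha> \<in> carrier_mat r w" "\<gamma> * ?C \<in> carrier_mat w ?n"
    using A B \<alpha> \<gamma> Cc Z mult_carrier_mat[OF Cc Z] by auto
  have "?M * ?N = ?N * ?M \<longleftrightarrow>
      (A * B + \<alpha> * \<gamma>) @\<^sub>c (?C * Z) = (B * A) @\<^sub>c (B * \<alpha>) \<and> 0\<^sub>m w ?n = \<gamma> * ?C"
    unfolding MN NM
    by (rule append_rows_eq_iff[OF carrier_append_cols[OF c(1,3)] carrier_append_cols[OF c(2,4)] zero_carrier_mat c(5)])
  also have "\<dots> \<longleftrightarrow> A * B + \<alpha> * \<gamma> = B * A \<and> ?C * Z = B * \<alpha> \<and> \<gamma> * ?C = 0\<^sub>m w ?n"
    using append_cols_eq_iff[OF c(1-4)] by auto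
  also have "\<dots> \<longleftrightarrow> \<gamma> = 0\<^sub>m w r \<and> A * B = B * A \<and> ?C * Z = B * \<alpha>"
    unfolding cancel[OF \<gamma>] using A B \<alpha> by auto
  finally have comm: "?M * ?N = ?N * ?M \<longleftrightarrow> \<gamma> = 0\<^sub>m w r \<and> A * B = B * A \<and> ?C * Z = B * \<alpha>" .
  have P: "A ^\<^sub>m b \<in> carrier_mat r r" using A by simp
  have "?M ^\<^sub>m Suc b = 0\<^sub>m ?n ?n \<longleftrightarrow> (A ^\<^sub>m b * ?C) @\<^sub>r 0\<^sub>m w ?n = 0\<^sub>m r ?n @\<^sub>r 0\<^sub>m w ?n"
    unfolding append_zero_rows_pow[OF A \<alpha>] by simp
  also have "\<dots> \<longleftrightarrow> A ^\<^sub>m b * ?C = 0\<^sub>m r ?n"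
    using append_rows_eq_iff[OF mult_carrier_mat[OF P Cc] zero_carrier_mat zero_carrier_mat zero_carrier_mat] by simp
  also have "\<dots> \<longleftrightarrow> A ^\<^sub>m b = 0\<^sub>m r r" by (rule cancel[OF P])
  finally have "?M ^\<^sub>m Suc b = 0\<^sub>m ?n ?n \<longleftrightarrow> A ^\<^sub>m b = 0\<^sub>m r r" .
  with comm show ?thesis using Mc Nc A B by (auto simp: commuting_nilp_pairs_def simp del: pow_mat.simps)
qed

text \<open>For a pair on the image whose first member has rank \<open>s\<close>, the extensions \<open>\<alpha>\<close> are counted by
  \<open>card_full_row_rank_extensions\<close>, and for each of them the solutions \<open>Z\<close> form an affine space of dimension \<open>w * w\<close>.\<close>

lemma card_adapted_pairs:
  "card (adapted_pairs (Suc b) r w :: ('a :: {field, finite} mat \<times> 'a mat) set)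
    = (\<Sum>s\<le>r. card (comm_pairs_of_rank b r s :: ('a mat \<times> 'a mat) set)
        * (CARD('a) ^ (s * w) * card (full_row_rank (r - s) w :: 'a mat set) * CARD('a) ^ (w * w)))"
proof -
  let ?n = "r + w"
  let ?P = "comm_pairs b r :: ('a mat \<times> 'a mat) set"
  let ?E = "\<lambda>A :: 'a mat. {\<alpha> \<in> carrier_mat r w. A @\<^sub>c \<alpha> \<in> full_row_rank r ?n}"
  let ?S = "\<lambda>(A :: 'a mat) B \<alpha>. {Z \<in> carrier_mat ?n w. (A @\<^sub>c \<alpha>) * Z = B * \<alpha>}"
  let ?T = "Sigma ?P (\<lambda>(A, B). Sigma (?E A) (?S A B))"
  let ?f = "\<lambda>((A, B), \<alpha>, Z). ((A @\<^sub>c \<alpha>) @\<^sub>r 0\<^sub>m w ?n, (B @\<^sub>r 0\<^sub>m w r) @\<^sub>c Z)"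
  have "bij_betw ?f ?T (adapted_pairs (Suc b) r w)"
  proof (rule bij_betw_imageI)
    show "inj_on ?f ?T"
    proof (rule inj_onI)
      fix x y assume "x \<in> ?T" "y \<in> ?T" and e: "?f x = ?f y"
      then obtain A B \<alpha> Z A' B' \<alpha>' Z' where x: "x = ((A, B), \<alpha>, Z)" "y = ((A', B'), \<alpha>', Z')"
        and P: "(A, B) \<in> ?P" "(A', B') \<in> ?P" and \<alpha>: "\<alpha> \<in> carrier_mat r w" "\<alpha>' \<in> carrier_mat r w"
        and Z: "Z \<in> carrier_mat ?n w" "Z' \<in> carrier_mat ?n w" by auto
      note c = comm_pairs_carrier[OF P(1)] comm_pairs_carrier[OF P(2)]
      have "A @\<^sub>c \<alpha> = A' @\<^sub>c \<alpha>'"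
        using e append_rows_eq_iff[OF carrier_append_cols[OF c(1) \<alpha>(1)] carrier_append_cols[OF c(3) \<alpha>(2)]
          zero_carrier_mat zero_carrier_mat] by (simp add: x)
      moreover have "B @\<^sub>r 0\<^sub>m w r = B' @\<^sub>r 0\<^sub>m w r \<and> Z = Z'"
        using e append_cols_eq_iff[OF carrier_append_rows[OF c(2) zero_carrier_mat]
          carrier_append_rows[OF c(4) zero_carrier_mat] Z] by (simp add: x)
      ultimately show "x = y"
        using append_cols_eq_iff[OF c(1,3) \<alpha>] append_rows_eq_iff[OF c(2,4) zero_carrier_mat zero_carrier_mat]
        by (simp add: x)
    qed
    show "?f ` ?T = adapted_pairs (Suc b) r w"
    proof (intro equalityI subsetI)
      fix y assume "y \<in> ?f ` ?T"
      then obtain A B \<alpha> Z where y: "y = ((A @\<^sub>c \<alpha>) @\<^sub>r 0\<^sub>m w ?n, (B @\<^sub>r 0\<^sub>m w r) @\<^sub>c Z)"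
        and P: "(A, B) \<in> ?P" and \<alpha>: "\<alpha> \<in> carrier_mat r w" "A @\<^sub>c \<alpha> \<in> full_row_rank r ?n"
        and Z: "Z \<in> carrier_mat ?n w" "(A @\<^sub>c \<alpha>) * Z = B * \<alpha>" by auto
      show "y \<in> adapted_pairs (Suc b) r w"
        using adapted_block_comm_pairs_iff[OF comm_pairs_carrier[OF P] zero_carrier_mat \<alpha>(1) Z(1) \<alpha>(2), of b]
          P \<alpha> Z by (auto simp: y adapted_pairs_def)
    next
      fix y :: "'a mat \<times> 'a mat" assume "y \<in> adapted_pairs (Suc b) r w"
      then obtain C N where y: "y = (C @\<^sub>r 0\<^sub>m w ?n, N)" and C: "C \<in> full_row_rank r ?n"
        and P: "(C @\<^sub>r 0\<^sub>m w ?n, N) \<in> comm_pairs (Suc b) ?n" by (auto simp: adapted_pairs_def)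
      obtain A \<alpha> where A: "A \<in> carrier_mat r r" and \<alpha>: "\<alpha> \<in> carrier_mat r w" and CA: "C = A @\<^sub>c \<alpha>"
        by (rule append_cols_split[OF full_row_rank_carrier[OF C]])
      obtain L Z where L: "L \<in> carrier_mat ?n r" and Z: "Z \<in> carrier_mat ?n w" and NL: "N = L @\<^sub>c Z"
        by (rule append_cols_split[OF comm_pairs_carrier(2)[OF P]])
      obtain B \<gamma> where B: "B \<in> carrier_mat r r" and \<gamma>: "\<gamma> \<in> carrier_mat w r" and LB: "L = B @\<^sub>r \<gamma>"
        by (rule append_rows_split[OF L])
      have "\<gamma> = 0\<^sub>m w r \<and> (A, B) \<in> ?P \<and> (A @\<^sub>c \<alpha>) * Z = B * \<alpha>"
        using adapted_block_comm_pairs_iff[OF A B \<gamma> \<alpha> Z, of b] P C by (simp add: CA NL LB)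
      then show "y \<in> ?f ` ?T"
        using C \<alpha> Z by (intro image_eqI[of _ _ "((A, B), \<alpha>, Z)"]) (auto simp: y CA NL LB)
    qed
  qed
  from bij_betw_same_card[OF this]
  have "card (adapted_pairs (Suc b) r w :: ('a mat \<times> 'a mat) set) = card ?T" by simp
  also have "\<dots> = (\<Sum>(A, B)\<in>?P. card (Sigma (?E A) (?S A B)))"
    by (subst card_SigmaI) (auto intro!: sum.cong)
  also have "\<dots> = (\<Sum>(A, B)\<in>?P. card (?E A) * CARD('a) ^ (w * w))"
  proof (rule sum.cong[OF refl], clarify)
    fix A B :: "'a mat" assume P: "(A, B) \<in> ?P"
    have "card (Sigma (?E A) (?S A B)) = (\<Sum>\<alpha>\<in>?E A. card (?S A B \<alpha>))"
      by (rule card_SigmaI) auto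
    also have "\<dots> = (\<Sum>\<alpha>\<in>?E A. CARD('a) ^ (w * w))"
      using comm_pairs_carrier[OF P] by (intro sum.cong card_solutions_full_row_rank) auto
    finally show "card (Sigma (?E A) (?S A B)) = card (?E A) * CARD('a) ^ (w * w)" by simp
  qed
  also have "?P = (\<Union>s\<le>r. comm_pairs_of_rank b r s)" by (rule comm_pairs_eq_UN_rank)
  also have "(\<Sum>(A, B)\<in>\<dots>. card (?E A) * CARD('a) ^ (w * w))
    = (\<Sum>s\<le>r. \<Sum>(A, B)\<in>comm_pairs_of_rank b r s. card (?E A) * CARD('a) ^ (w * w))"
  proof (rule sum.UNION_disjoint)
    show "\<forall>s\<in>{..r}. \<forall>t\<in>{..r}. s \<noteq> t \<longrightarrow>
        comm_pairs_of_rank b r s \<inter> (comm_pairs_of_rank b r t :: ('a mat \<times> 'a mat) set) = {}"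
      by (auto simp: comm_pairs_of_rank_disjoint)
  qed auto
  also have "\<dots> = (\<Sum>s\<le>r. \<Sum>(A, B)\<in>(comm_pairs_of_rank b r s :: ('a mat \<times> 'a mat) set).
      CARD('a) ^ (s * w) * card (full_row_rank (r - s) w :: 'a mat set) * CARD('a) ^ (w * w))"
    by (intro sum.cong refl) (auto simp: comm_pairs_of_rank_def card_full_row_rank_extensions dest: comm_pairs_carrier)
  finally show ?thesis by simp
qed

lemma card_comm_pairs_eq_sum_rank:
  "card (comm_pairs b n :: ('a :: {field, finite} mat \<times> 'a mat) set)
    = (\<Sum>r\<le>n. card (comm_pairs_of_rank b n r :: ('a mat \<times> 'a mat) set))"
  unfolding comm_pairs_eq_UN_rank by (rule card_UN_disjoint) (auto simp: comm_pairs_of_rank_disjoint)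

section \<open>The recurrence for the normalised counts\<close>

text \<open>The number of all square matrices of size \<open>m\<close> divided by the number of invertible ones.\<close>

definition gl_ratio :: "'a :: {field, finite} itself \<Rightarrow> nat \<Rightarrow> real" where
  "gl_ratio _ m = real (CARD('a)) ^ (m * m) / real (card (GL m :: 'a mat set))"

text \<open>The normalised number of commuting pairs of size \<open>r + w\<close> in which \<open>A\<close> has nullity \<open>w\<close>
  and rank \<open>r\<close>.\<close>

definition pair_ratio :: "'a :: {field, finite} itself \<Rightarrow> nat \<Rightarrow> nat \<Rightarrow> nat \<Rightarrow> real" where
  "pair_ratio _ b w r = real (card (comm_pairs_of_rank b (r + w) r :: ('a mat \<times> 'a mat) set))
     / real (card (GL (r + w) :: 'a mat set))"

lemma CARD_field_gt_1: "CARD('a :: {field, finite}) > 1"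
  using card_mono[of UNIV "{0, 1 :: 'a}"] by auto

lemma full_row_rank_eq_empty: "w < k \<Longrightarrow> (full_row_rank k w :: 'a :: {field, finite} mat set) = {}"
  using full_row_rank_le by fastforce

text \<open>Here \<open>k\<close> is the nullity of the restriction of \<open>A\<close> to its image. All powers of the field size
  that come from the extension problem combine to the exponent \<open>(w - k)\<^sup>2\<close> in \<^const>\<open>gl_ratio\<close>.\<close>

lemma pair_ratio_Suc:
  "pair_ratio TYPE('a :: {field, finite}) (Suc b) w r
    = (\<Sum>k\<le>min w r. gl_ratio TYPE('a) (w - k) * pair_ratio TYPE('a) b k (r - k))"
proof -
  define q where "q = real CARD('a)"
  define G where "G = (\<lambda>m. real (card (GL m :: 'a mat set)))"
  define N where "N = (\<lambda>s. real (card (comm_pairs_of_rank b r s :: ('a mat \<times> 'a mat) set)))"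
  define F where "F = (\<lambda>k. real (card (full_row_rank k w :: 'a mat set)))"
  have q: "q > 0" by (simp add: q_def)
  have G: "G m > 0" for m using card_GL_pos by (simp add: G_def)
  have GL: "real (card (GL m :: 'a mat set)) = G m" for m by (simp add: G_def)
  have "real (card (comm_pairs_of_rank (Suc b) (r + w) r :: ('a mat \<times> 'a mat) set)) * (G r * (q ^ (r * w) * G w))
      = real (card (adapted_pairs (Suc b) r w :: ('a mat \<times> 'a mat) set)) * G (r + w)"
    using arg_cong[OF card_comm_pairs_of_rank[of "Suc b" r w, where 'a = 'a], of real]
    by (simp add: G_def q_def)
  then have "pair_ratio TYPE('a) (Suc b) w r
      = real (card (adapted_pairs (Suc b) r w :: ('a mat \<times> 'a mat) set)) / (G r * (q ^ (r * w) * G w))"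
    using G[of r] G[of w] G[of "r + w"] q by (simp add: pair_ratio_def GL field_simps)
  also have "\<dots> = (\<Sum>s\<le>r. N s * (q ^ (s * w) * F (r - s) * q ^ (w * w)) / (G r * (q ^ (r * w) * G w)))"
    unfolding card_adapted_pairs by (simp add: N_def F_def q_def sum_divide_distrib)
  also have "\<dots> = (\<Sum>k\<le>r. N (r - k) * (q ^ ((r - k) * w) * F k * q ^ (w * w)) / (G r * (q ^ (r * w) * G w)))"
    by (rule sum.reindex_bij_witness[of _ "\<lambda>k. r - k" "\<lambda>s. r - s"]) auto
  also have "\<dots> = (\<Sum>k\<le>min w r. N (r - k) * (q ^ ((r - k) * w) * F k * q ^ (w * w)) / (G r * (q ^ (r * w) * G w)))"
    by (rule sum.mono_neutral_right) (auto simp: F_def full_row_rank_eq_empty)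
  also have "\<dots> = (\<Sum>k\<le>min w r. gl_ratio TYPE('a) (w - k) * pair_ratio TYPE('a) b k (r - k))"
  proof (rule sum.cong[OF refl])
    fix k assume "k \<in> {..min w r}"
    then obtain s v where r: "r = s + k" and w: "w = k + v"
      by (metis atMost_iff le_add_diff_inverse le_add_diff_inverse2 min.bounded_iff)
    have GF: "G w = F k * (q ^ (v * k) * G v)"
      unfolding w using arg_cong[OF card_GL_eq_card_full_row_rank[of k v, where 'a = 'a], of real]
      by (simp add: G_def F_def q_def w)
    then have F: "F k > 0" using G[of w] G[of v] q
      by (metis F_def mult_zero_left of_nat_0_less_iff of_nat_0 less_numeral_extra(3) neq0_conv)
    have e: "s * w + w * w = r * w + v * k + v * v" by (simp add: r w algebra_simps)
    have "q ^ (s * w) * q ^ (w * w) = q ^ (r * w) * q ^ (v * k) * q ^ (v * v)"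
      using arg_cong[OF e, of "\<lambda>i. q ^ i"] by (simp only: power_add)
    then have "(q ^ (s * w) * F k * q ^ (w * w)) / (q ^ (r * w) * G w) = q ^ (v * v) / G v"
      unfolding GF using F q G[of v] by (simp add: field_simps)
    moreover have "N (r - k) * (q ^ ((r - k) * w) * F k * q ^ (w * w)) / (G r * (q ^ (r * w) * G w))
       = N s / G r * ((q ^ (s * w) * F k * q ^ (w * w)) / (q ^ (r * w) * G w))"
      by (simp add: r)
    ultimately show "N (r - k) * (q ^ ((r - k) * w) * F k * q ^ (w * w)) / (G r * (q ^ (r * w) * G w))
      = gl_ratio TYPE('a) (w - k) * pair_ratio TYPE('a) b k (r - k)"
      by (simp add: gl_ratio_def pair_ratio_def r w N_def G_def q_def mult.commute)
  qed
  finally show ?thesis .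
qed

lemma carrier_mat_0_0: "carrier_mat 0 0 = {1\<^sub>m 0 :: 'a :: {zero, one} mat}"
proof (intro equalityI subsetI)
  fix A :: "'a mat" assume A: "A \<in> carrier_mat 0 0"
  have "A = 1\<^sub>m 0" by (rule eq_matI) (use A in simp_all)
  then show "A \<in> {1\<^sub>m 0}" by simp
qed simp

lemma GL_0: "GL 0 = {1\<^sub>m 0 :: 'a :: field mat}"
  using GL_one[of 0, where 'a = 'a] GL_carrier[of _ 0, where 'a = 'a] unfolding carrier_mat_0_0 by blast

text \<open>The zeroth power of a matrix is the identity, which vanishes only in size \<open>0\<close>.\<close>

lemma pair_ratio_0: "pair_ratio TYPE('a :: {field, finite}) 0 w r = (if w = 0 \<and> r = 0 then 1 else 0)"
proof (cases "r + w = 0")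
  case True
  have "(comm_pairs_of_rank 0 0 0 :: ('a mat \<times> 'a mat) set) = {(1\<^sub>m 0, 1\<^sub>m 0)}"
  proof -
    have "has_rank 0 0 (1\<^sub>m 0 :: 'a mat) 0"
      by (rule has_rank_exists[of "1\<^sub>m 0 :: 'a mat" 0 0]) (auto simp: has_rank_def)
    moreover have "(1\<^sub>m 0 :: 'a mat) = 0\<^sub>m 0 0" by (intro eq_matI) auto
    ultimately show ?thesis
      by (auto simp: comm_pairs_of_rank_def commuting_nilp_pairs_def carrier_mat_0_0)
  qed
  then show ?thesis using True by (simp add: pair_ratio_def GL_0)
next
  case False
  have "(1\<^sub>m n :: 'a mat) \<noteq> 0\<^sub>m n n" if "n > 0" for n
    using that index_one_mat(1)[of 0 n 0] index_zero_mat(1)[of 0 n 0 n] by (metis zero_neq_one)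
  then have "(comm_pairs 0 (r + w) :: ('a mat \<times> 'a mat) set) = {}"
    using False by (auto simp: commuting_nilp_pairs_def)
  then have "(comm_pairs_of_rank 0 (r + w) r :: ('a mat \<times> 'a mat) set) = {}"
    by (auto simp: comm_pairs_of_rank_def)
  then show ?thesis using False by (auto simp: pair_ratio_def)
qed

section \<open>Generating functions\<close>

text \<open>The series \<open>\<Sum>\<^sub>m gl_ratio m t\<^sup>i\<^sup>m\<close>; for \<open>i > 0\<close> each inner sum has at most
  one term.\<close>

definition gl_series :: "'a :: {field, finite} itself \<Rightarrow> nat \<Rightarrow> real fps" where
  "gl_series T i = Abs_fps (\<lambda>n. \<Sum>m | i * m = n. gl_ratio T m)"

text \<open>Generating function of the normalised counts in which the rank \<open>r\<close> has weight \<open>1\<close> and the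
  nullity \<open>w\<close> has weight \<open>s + 1\<close>.\<close>

definition pair_series :: "'a :: {field, finite} itself \<Rightarrow> nat \<Rightarrow> nat \<Rightarrow> real fps" where
  "pair_series T b s = Abs_fps (\<lambda>n. \<Sum>(w, r) | r + Suc s * w = n. pair_ratio T b w r)"

lemma finite_weighted_compositions: "finite {(w, r). r + Suc s * w = n}"
  by (rule finite_subset[of _ "{..n} \<times> {..n}"]) auto

lemma finite_multiples_eq: "finite {m. Suc s * m = (n :: nat)}"
  by (rule finite_subset[of _ "{..n}"]) auto

lemma pair_series_0: "pair_series (TYPE('a :: {field, finite})) 0 s = 1"
proof (rule fps_ext)
  fix n
  have "fps_nth (pair_series (TYPE('a)) 0 s) n
      = (\<Sum>(w, r) | r + Suc s * w = n. if w = 0 \<and> r = 0 then 1 else 0)"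
    by (simp add: pair_series_def pair_ratio_0)
  also have "\<dots> = (\<Sum>p \<in> {(w, r). r + Suc s * w = n}. if p = (0, 0) then 1 else 0)"
    by (rule sum.cong) (auto split: if_splits)
  also have "\<dots> = (if n = 0 then 1 else 0)"
    by (subst sum.delta[OF finite_weighted_compositions]) auto
  finally show "fps_nth (pair_series (TYPE('a)) 0 s) n = fps_nth 1 n" by simp
qed

text \<open>Passing to the image replaces \<open>(w, r)\<close> by \<open>(k, r - k)\<close>. With \<open>m = w - k\<close> the weight is
  \<open>r + (s + 1) * w = (s + 1) * m + ((r - k) + (s + 2) * k)\<close>, so the recurrence becomes a product in
  which the weight of the nullity grows by one.\<close>

lemma pair_series_Suc:
  "pair_series TYPE('a :: {field, finite}) (Suc b) s = gl_series TYPE('a) (Suc s) * pair_series TYPE('a) b (Suc s)"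
proof (rule fps_ext)
  fix n
  let ?c = "\<lambda>(m, k, r). gl_ratio TYPE('a) m * pair_ratio TYPE('a) b k r"
  let ?W = "\<lambda>s n. {(w, r). r + Suc s * w = (n :: nat)}"
  let ?M = "\<lambda>n. {m. Suc s * m = (n :: nat)}"
  let ?S = "{(m, k, r). Suc s * m + (r + Suc (Suc s) * k) = n}"
  have "fps_nth (gl_series TYPE('a) (Suc s) * pair_series TYPE('a) b (Suc s)) n
      = (\<Sum>i=0..n. (\<Sum>m\<in>?M i. gl_ratio TYPE('a) m) * (\<Sum>(k, r)\<in>?W (Suc s) (n - i). pair_ratio TYPE('a) b k r))"
    by (simp add: fps_mult_nth gl_series_def pair_series_def)
  also have "\<dots> = (\<Sum>i=0..n. \<Sum>p\<in>?M i \<times> ?W (Suc s) (n - i). ?c p)"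
    by (simp add: sum_product sum.cartesian_product case_prod_beta)
  also have "\<dots> = (\<Sum>(i, p)\<in>Sigma {0..n} (\<lambda>i. ?M i \<times> ?W (Suc s) (n - i)). ?c p)"
    by (intro sum.Sigma ballI finite_cartesian_product finite_weighted_compositions finite_multiples_eq) simp
  also have "\<dots> = (\<Sum>p\<in>?S. ?c p)"
    by (rule sum.reindex_bij_witness[of _ "\<lambda>(m, k, r). (Suc s * m, m, k, r)" "\<lambda>(i, p). p"]) auto
  also have "\<dots> = (\<Sum>((w, r), k)\<in>Sigma (?W s n) (\<lambda>(w, r). {..min w r}).
      gl_ratio TYPE('a) (w - k) * pair_ratio TYPE('a) b k (r - k))"
    by (rule sum.reindex_bij_witness[of _ "\<lambda>((w, r), k). (w - k, k, r - k)" "\<lambda>(m, k, r). ((m + k, r + k), k)"])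
      (auto simp: algebra_simps)
  also have "\<dots> = (\<Sum>(w, r)\<in>?W s n. \<Sum>k\<le>min w r. gl_ratio TYPE('a) (w - k) * pair_ratio TYPE('a) b k (r - k))"
    using finite_weighted_compositions[of s n] by (subst sum.Sigma[symmetric]) (auto simp: case_prod_beta)
  also have "\<dots> = fps_nth (pair_series TYPE('a) (Suc b) s) n"
    by (simp add: pair_series_def pair_ratio_Suc case_prod_beta)
  finally show "fps_nth (pair_series TYPE('a) (Suc b) s) n = fps_nth (gl_series TYPE('a) (Suc s) * pair_series TYPE('a) b (Suc s)) n"
    by simp
qed

lemma pair_series_eq_prod:
  "pair_series TYPE('a :: {field, finite}) b s = (\<Prod>i=1..b. gl_series TYPE('a) (i + s))"
proof (induction b arbitrary: s)
  case 0
  then show ?case by (simp add: pair_series_0)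
next
  case (Suc b)
  have "(\<Prod>i=1..Suc b. gl_series TYPE('a) (i + s)) = gl_series TYPE('a) (Suc s) * (\<Prod>i=1..b. gl_series TYPE('a) (i + Suc s))"
    by (simp add: prod.atLeast_Suc_atMost prod.shift_bounds_cl_Suc_ivl del: prod.cl_ivl_Suc)
  then show ?case by (simp add: pair_series_Suc Suc.IH)
qed

lemma pair_series_nth_unweighted:
  "fps_nth (pair_series TYPE('a :: {field, finite}) b 0) n
    = real (card (comm_pairs b n :: ('a mat \<times> 'a mat) set)) / real (card (GL n :: 'a mat set))"
proof -
  have "fps_nth (pair_series TYPE('a) b 0) n = (\<Sum>r\<le>n. pair_ratio TYPE('a) b (n - r) r)"
    unfolding pair_series_def fps_nth_Abs_fps
    by (rule sum.reindex_bij_witness[of _ "\<lambda>r. (n - r, r)" "\<lambda>(w, r). r"]) auto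
  also have "\<dots> = (\<Sum>r\<le>n. real (card (comm_pairs_of_rank b n r :: ('a mat \<times> 'a mat) set)) / real (card (GL n :: 'a mat set)))"
    by (rule sum.cong) (auto simp: pair_ratio_def)
  finally show ?thesis by (simp add: card_comm_pairs_eq_sum_rank sum_divide_distrib)
qed

section \<open>Euler's product\<close>

text \<open>A single row has full row rank iff it is nonzero. Peeling off the first row of an invertible
  matrix then evaluates the order of the general linear group.\<close>

lemma full_row_rank_single_row: "(full_row_rank 1 n :: 'a :: field mat set) = carrier_mat 1 n - {0\<^sub>m 1 n}"
proof (intro equalityI subsetI)
  fix C :: "'a mat" assume C: "C \<in> full_row_rank 1 n"
  then obtain D where D: "D \<in> carrier_mat n 1" "C * D = 1\<^sub>m 1" by (auto simp: full_row_rank_def)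
  have "C \<noteq> 0\<^sub>m 1 n"
  proof
    assume "C = 0\<^sub>m 1 n"
    then have "(1\<^sub>m 1 :: 'a mat) = 0\<^sub>m 1 1" using D by simp
    then have "(1\<^sub>m 1 :: 'a mat) $$ (0, 0) = 0\<^sub>m 1 1 $$ (0, 0)" by (rule arg_cong)
    then show False by simp
  qed
  with C show "C \<in> carrier_mat 1 n - {0\<^sub>m 1 n}" by (auto dest: full_row_rank_carrier)
next
  fix C :: "'a mat" assume "C \<in> carrier_mat 1 n - {0\<^sub>m 1 n}"
  then have C: "C \<in> carrier_mat 1 n" and "C \<noteq> 0\<^sub>m 1 n" by auto
  then obtain j where j: "j < n" "C $$ (0, j) \<noteq> 0" by (auto simp: mat_eq_iff)
  define D where "D = mat n 1 (\<lambda>(i, _). if i = j then 1 / C $$ (0, j) else 0)"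
  have "C * D = 1\<^sub>m 1"
  proof (rule eq_matI)
    fix i l assume "i < dim_row (1\<^sub>m 1 :: 'a mat)" "l < dim_col (1\<^sub>m 1 :: 'a mat)"
    then have il: "i = 0" "l = 0" by auto
    have "(C * D) $$ (0, 0) = (\<Sum>k<n. C $$ (0, k) * D $$ (k, 0))"
      using C by (simp add: scalar_prod_def D_def atLeast0LessThan)
    also have "\<dots> = (\<Sum>k<n. if k = j then 1 else 0)"
      using j by (intro sum.cong) (auto simp: D_def)
    finally show "(C * D) $$ (i, l) = (1\<^sub>m 1 :: 'a mat) $$ (i, l)" using j by (simp add: il)
  qed (use C in \<open>auto simp: D_def\<close>)
  then show "C \<in> full_row_rank 1 n" by (intro full_row_rankI[OF C]) (auto simp: D_def)
qed

lemma gl_ratio_eq_prod: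
  "gl_ratio TYPE('a :: {field, finite}) m = (\<Prod>l<m. 1 / (1 - (1 / real CARD('a)) ^ Suc l))"
proof (induction m)
  case 0
  then show ?case by (simp add: gl_ratio_def GL_0)
next
  case (Suc m)
  define q where "q = real CARD('a)"
  define G where "G = (\<lambda>m. real (card (GL m :: 'a mat set)))"
  have q: "q > 1" using CARD_field_gt_1[where 'a = 'a] by (simp add: q_def)
  then have qm: "q ^ Suc m > 1" by (rule one_less_power) simp
  have G: "G m > 0" using card_GL_pos by (simp add: G_def)
  have GL: "real (card (GL m :: 'a mat set)) = G m" for m by (simp add: G_def)
  have "card (full_row_rank 1 (Suc m) :: 'a mat set) = CARD('a) ^ Suc m - 1"
    unfolding full_row_rank_single_row by (subst card_Diff_singleton) (auto simp: card_carrier_mat)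
  moreover have "CARD('a) ^ Suc m \<ge> 1" by simp
  ultimately have "real (card (full_row_rank 1 (Suc m) :: 'a mat set)) = q ^ Suc m - 1"
    by (simp only: of_nat_diff of_nat_power q_def of_nat_1)
  then have GS: "G (Suc m) = (q ^ Suc m - 1) * (q ^ m * G m)"
    using arg_cong[OF card_GL_eq_card_full_row_rank[of 1 m, where 'a = 'a], of real]
    by (simp add: G_def q_def)
  have "q ^ (Suc m * Suc m) = q ^ (m * m) * (q ^ m * q ^ Suc m)"
    by (simp flip: power_add) (simp add: power_add)
  then have "gl_ratio TYPE('a) (Suc m) = (q ^ (m * m) * (q ^ m * q ^ Suc m)) / ((q ^ Suc m - 1) * (q ^ m * G m))"
    by (simp only: gl_ratio_def GL GS flip: q_def)
  also have "\<dots> = (q ^ (m * m) / G m) * (q ^ Suc m / (q ^ Suc m - 1))"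
    using q by simp
  also have "q ^ Suc m / (q ^ Suc m - 1) = 1 / (1 - (1 / q) ^ Suc m)"
    using q qm by (simp add: field_simps)
  also have "q ^ (m * m) / G m = gl_ratio TYPE('a) m" by (simp add: gl_ratio_def q_def G_def)
  finally show ?case using Suc.IH by (simp add: q_def)
qed

text \<open>The coefficients of the partial products, a form of the \<open>q\<close>-binomial theorem.\<close>

lemma fps_nth_partial_product:
  fixes x :: real
  assumes x: "0 < x" "x < 1" and i: "i > 0"
  shows "fps_nth (\<Prod>j<N. 1 / (1 - fps_const (x ^ j) * fps_X ^ i)) n
    = (if i dvd n then \<Prod>l<n div i. (1 - x ^ (N + l)) / (1 - x ^ Suc l) else 0)"
proof -
  \<comment> \<open>The claimed coefficients form a series that satisfies the same recurrence in \<open>N\<close> as the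
    partial products: multiplication by the last factor takes it back to \<open>N\<close>.\<close>
  define a where "a = (\<lambda>N m. \<Prod>l<m. (1 - x ^ (N + l)) / (1 - x ^ Suc l))"
  define F where "F = (\<lambda>N. Abs_fps (\<lambda>n. if i dvd n then a N (n div i) else 0))"
  have ne: "1 - x ^ Suc l \<noteq> 0" for l
    using power_Suc_less_one[OF x, of l] by simp
  have rec: "a (Suc N) (Suc m) = a N (Suc m) + x ^ N * a (Suc N) m" for N m
  proof -
    define P where "P = (\<Prod>l<m. (1 - x ^ (Suc N + l)) / (1 - x ^ Suc l))"
    have "a N (Suc m) = (\<Prod>l<Suc m. 1 - x ^ (N + l)) / (\<Prod>l<Suc m. 1 - x ^ Suc l)"
      by (simp only: a_def prod_dividef)
    also have "(\<Prod>l<Suc m. 1 - x ^ (N + l)) = (1 - x ^ N) * (\<Prod>l<m. 1 - x ^ (Suc N + l))"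
      by (subst prod.lessThan_Suc_shift) simp
    also have "(\<Prod>l<Suc m. 1 - x ^ Suc l) = (\<Prod>l<m. 1 - x ^ Suc l) * (1 - x ^ Suc m)" by simp
    finally have "a N (Suc m) = (1 - x ^ N) / (1 - x ^ Suc m) * P"
      by (simp add: P_def prod_dividef)
    moreover have "a (Suc N) (Suc m) = P * ((1 - x ^ (Suc N + m)) / (1 - x ^ Suc m))"
      by (simp add: a_def P_def)
    moreover have "a (Suc N) m = P" by (simp add: a_def P_def)
    moreover have "P * (1 - x ^ (Suc N + m)) = (1 - x ^ N) * P + x ^ N * P * (1 - x ^ Suc m)"
      by (simp add: algebra_simps power_add)
    ultimately show ?thesis using ne[of m] by (simp add: add_divide_distrib)
  qed
  have step: "F (Suc N) * (1 - fps_const (x ^ N) * fps_X ^ i) = F N" for N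
  proof (rule fps_ext)
    fix n
    have "fps_nth (F (Suc N) * (1 - fps_const (x ^ N) * fps_X ^ i)) n
        = fps_nth (F (Suc N) - fps_const (x ^ N) * (fps_X ^ i * F (Suc N))) n"
      by (simp add: algebra_simps)
    also have "\<dots> = fps_nth (F (Suc N)) n - x ^ N * (if n < i then 0 else fps_nth (F (Suc N)) (n - i))"
      by (simp add: fps_X_power_mult_nth)
    also have "\<dots> = fps_nth (F N) n"
    proof (cases "i dvd n")
      case True
      then obtain m where n: "n = i * m" by auto
      show ?thesis
      proof (cases m)
        case 0
        then show ?thesis using i n by (simp add: F_def a_def)
      next
        case (Suc k)
        then have "n - i = i * k" "\<not> n < i" using n by auto
        then show ?thesis using i n Suc rec[of N k] by (simp add: F_def)
      qed
    next
      case False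
      then have "\<not> i dvd n - i" if "\<not> n < i" using that by (auto simp: dvd_minus_self)
      with False show ?thesis by (simp add: F_def)
    qed
    finally show "fps_nth (F (Suc N) * (1 - fps_const (x ^ N) * fps_X ^ i)) n = fps_nth (F N) n" .
  qed
  have "(\<Prod>j<N. 1 / (1 - fps_const (x ^ j) * fps_X ^ i)) = F N"
  proof (induction N)
    case 0
    \<comment> \<open>The factor with \<open>l = 0\<close> vanishes, as its numerator is \<open>1 - x\<^sup>0\<close>.\<close>
    have "a 0 m = 0" if "m > 0" for m
      using that unfolding a_def by (intro prod_zero) (auto intro: bexI[of _ 0])
    then have "F 0 = 1"
      using i by (intro fps_ext) (auto simp: F_def a_def dvd_div_eq_0_iff)
    then show ?case by simp
  next
    case (Suc N)
    let ?u = "1 - fps_const (x ^ N) * fps_X ^ i :: real fps"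
    have u0: "fps_nth ?u 0 \<noteq> 0" using i by simp
    have "(\<Prod>j<Suc N. 1 / (1 - fps_const (x ^ j) * fps_X ^ i)) = F N * inverse ?u"
      using Suc.IH u0 by (simp add: fps_divide_unit)
    also have "\<dots> = F (Suc N) * (inverse ?u * ?u)"
      unfolding step[of N, symmetric] by (simp only: ac_simps)
    also have "\<dots> = F (Suc N)" using inverse_mult_eq_1[OF u0] by simp
    finally show ?case .
  qed
  then show ?thesis by (simp add: F_def a_def)
qed

text \<open>As the number of factors grows, the numerators of these coefficients tend to one, which leaves
  the product formula for \<^const>\<open>gl_ratio\<close>.\<close>

lemma partial_product_tendsto:
  assumes i: "i > 0"
  shows "(\<lambda>N. fps_nth (\<Prod>j<N. 1 / (1 - fps_const (1 / real CARD('a :: {field, finite}) ^ j) * fps_X ^ i)) n)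
    \<longlonglongrightarrow> fps_nth (gl_series TYPE('a) i) n"
proof -
  define x where "x = 1 / real CARD('a)"
  have x: "0 < x" "x < 1" using CARD_field_gt_1[where 'a = 'a] by (auto simp: x_def)
  have xj: "1 / real CARD('a) ^ j = x ^ j" for j by (simp add: x_def power_one_over)
  have "(\<lambda>N. \<Prod>l<m. (1 - x ^ (N + l)) / (1 - x ^ Suc l)) \<longlonglongrightarrow> (\<Prod>l<m. (1 - 0) / (1 - x ^ Suc l))" for m
  proof (intro tendsto_prod tendsto_divide tendsto_diff tendsto_const)
    fix l
    show "(\<lambda>N. x ^ (N + l)) \<longlonglongrightarrow> 0"
      using LIMSEQ_ignore_initial_segment[OF LIMSEQ_realpow_zero[of x], of l] x by simp
    show "1 - x ^ Suc l \<noteq> 0" using power_Suc_less_one[OF x, of l] by simp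
  qed
  then have lim: "(\<lambda>N. \<Prod>l<m. (1 - x ^ (N + l)) / (1 - x ^ Suc l)) \<longlonglongrightarrow> gl_ratio TYPE('a) m" for m
    by (simp add: gl_ratio_eq_prod x_def)
  have "fps_nth (gl_series TYPE('a) i) n = (if i dvd n then gl_ratio TYPE('a) (n div i) else 0)"
  proof (cases "i dvd n")
    case True
    then have "{m. i * m = n} = {n div i}" using i by auto
    then show ?thesis using True by (simp add: gl_series_def)
  next
    case False
    then have "{m. i * m = n} = {}" by auto
    then show ?thesis using False by (simp add: gl_series_def)
  qed
  then show ?thesis
    unfolding xj fps_nth_partial_product[OF x i] using lim by simp
qed

theorem corollary4p5:
  fixes q b :: nat
  assumes "card (UNIV :: 'a::{field,finite} set) = q"
    and "b \<ge> 1"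
  shows "(\<forall>i\<in>{1..b}. fps_coeffwise_convergent_prod (\<lambda>j. 1 / (1 - fps_const (1 / real q ^ j) * fps_X ^ i))) \<and>
    Abs_fps (\<lambda>n. real (card (commuting_nilp_pairs TYPE('a) b n)) / real (card (GL_mats TYPE('a) n)))
      = (\<Prod>i=1..b. fps_coeffwise_prodinf (\<lambda>j. 1 / (1 - fps_const (1 / real q ^ j) * fps_X ^ i)))"
proof
  have lim: "(\<lambda>N. fps_nth (\<Prod>j<N. 1 / (1 - fps_const (1 / real q ^ j) * fps_X ^ i)) n)
      \<longlonglongrightarrow> fps_nth (gl_series TYPE('a) i) n" if "i \<in> {1..b}" for i n
    using partial_product_tendsto[of i n, where 'a = 'a] that assms(1) by simp
  then show "\<forall>i\<in>{1..b}. fps_coeffwise_convergent_prod (\<lambda>j. 1 / (1 - fps_const (1 / real q ^ j) * fps_X ^ i))"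
    unfolding fps_coeffwise_convergent_prod_def by (blast intro: convergentI)
  have "fps_coeffwise_prodinf (\<lambda>j. 1 / (1 - fps_const (1 / real q ^ j) * fps_X ^ i)) = gl_series TYPE('a) i"
    if "i \<in> {1..b}" for i
    by (rule fps_ext) (simp add: fps_coeffwise_prodinf_def limI[OF lim[OF that]])
  then have "(\<Prod>i=1..b. fps_coeffwise_prodinf (\<lambda>j. 1 / (1 - fps_const (1 / real q ^ j) * fps_X ^ i)))
      = pair_series TYPE('a) b 0"
    by (simp add: pair_series_eq_prod)
  moreover have "Abs_fps (\<lambda>n. real (card (comm_pairs b n :: ('a mat \<times> 'a mat) set)) / real (card (GL n :: 'a mat set)))
      = pair_series TYPE('a) b 0"
    by (rule fps_ext) (simp add: pair_series_nth_unweighted)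
  ultimately show "Abs_fps (\<lambda>n. real (card (commuting_nilp_pairs TYPE('a) b n)) / real (card (GL_mats TYPE('a) n)))
      = (\<Prod>i=1..b. fps_coeffwise_prodinf (\<lambda>j. 1 / (1 - fps_const (1 / real q ^ j) * fps_X ^ i)))"
    by simp
qed

end
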